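(* Let $V$ be an admissible potential, let $a:=\int_0^\infty V$, and for $\gamma>0$ define on the set $\mathcal P([0,\infty))$ of Borel probability measures on $[0,\infty)$ $$E_\gamma(\mu):=\frac12\gamma\int_0^\infty\!\!\int_0^\infty V(\gamma(x-y))\,\mu(dx)\mu(dy)+\int_0^\infty x\,\mu(dx)\in[0,+\infty].$$ Then the $\Gamma$-limit of $E_\gamma$ as $\gamma\to\infty$ with respect to the narrow topology on $\mathcal P([0,\infty))$ is $$E(\mu)=\begin{cases}\displaystyle a\int_0^\infty\rho(x)^2\,dx+\int_0^\infty x\rho(x)\,dx,&\text{if }\mu(dx)=\rho(x)\,dx,\\ +\infty,&\text{otherwise.}\end{cases}$$ In addition, sequences $(\mu_\gamma)$ in $\mathcal P([0,\infty))$ along which $E_\gamma(\mu_\gamma)$ is bounded are compact (that is, pre-compact) in the narrow topology.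
   Context: **Admissible potential.** $V:\mathbb R\to\mathbb R$ satisfying: (V1) $V$ is even, and decreasing on $(0,\infty)$; (V2) $\int_{\mathbb R}|V|<\infty$ and $\int_{\mathbb R}|x|V(x)\,dx<\infty$; (V3) $\widehat V>0$ on $\mathbb R$ and $\sqrt{\widehat V}\in W^{2,\infty}(\mathbb R)$, where $\widehat f(\omega)=\int_{\mathbb R}f(x)e^{-2\pi i x\omega}\,dx$; (V4) there are bounded continuous functions $V_k$ on $\mathbb R$ with non-negative Fourier transform such that $V_k\uparrow V$ pointwise a.e. and $\|V-V_k\|_{L^1(\mathbb R)}\to0$. The value at the origin is $V(0):=\lim_{x\downarrow0}V(x)\in(0,+\infty]$ (so $V(0)=+\infty$ is allowed). The narrow topology is convergence against bounded continuous functions. $\Gamma$-convergence of $E_\gamma$ to $E$ means: $\liminf_{\gamma\to\infty}E_\gamma(\mu_\gamma)\ge E(\mu)$ whenever $\mu_\gamma\to\mu$ narrowly, and for every $\mu$ there exist $\mu_\gamma\to\mu$ narrowly with $\limsup_{\gamma\to\infty}E_\gamma(\mu_\gamma)\le E(\mu)$. *)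

theory Defs
  imports "HOL-Probability.Probability"
begin

definition fourier :: "(real \<Rightarrow> real) \<Rightarrow> real \<Rightarrow> complex" where
  "fourier f \<omega> =
     (\<integral>x. complex_of_real (f x) * exp (- (2 * complex_of_real pi * \<i> * complex_of_real (x * \<omega>))) \<partial>lborel)"

definition test_function :: "(real \<Rightarrow> real) \<Rightarrow> bool" where
  "test_function \<phi> \<longleftrightarrow>
     (\<forall>n x. (deriv ^^ n) \<phi> differentiable (at x)) \<and> (\<exists>R. \<forall>x. R < \<bar>x\<bar> \<longrightarrow> \<phi> x = 0)"

definition L_infinity :: "(real \<Rightarrow> real) \<Rightarrow> bool" where
  "L_infinity f \<longleftrightarrow> f \<in> borel_measurable lborel \<and> (\<exists>C. AE x in lborel. \<bar>f x\<bar> \<le> C)"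

definition weak_deriv :: "nat \<Rightarrow> (real \<Rightarrow> real) \<Rightarrow> (real \<Rightarrow> real) \<Rightarrow> bool" where
  "weak_deriv j f g \<longleftrightarrow>
     (\<forall>\<phi>. test_function \<phi> \<longrightarrow>
        (\<integral>x. f x * (deriv ^^ j) \<phi> x \<partial>lborel) = (-1) ^ j * (\<integral>x. g x * \<phi> x \<partial>lborel))"

text \<open>The Sobolev space \<open>W\<^sup>k\<^sup>,\<^sup>\<infinity>(\<real>)\<close>.\<close>

definition sobolev_infinity :: "nat \<Rightarrow> (real \<Rightarrow> real) \<Rightarrow> bool" where
  "sobolev_infinity k f \<longleftrightarrow>
     L_infinity f \<and> (\<forall>j\<le>k. \<exists>g. L_infinity g \<and> weak_deriv j f g)"

text \<open>The value of a real-valued potential at the single point \<open>0\<close> plays no role in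
  the conditions below; in the energy it is replaced by the possibly infinite limit at the
  origin, see \<open>pot_ext\<close>. ``Decreasing'' is meant in the weak sense.\<close>

definition admissible :: "(real \<Rightarrow> real) \<Rightarrow> bool" where
  "admissible V \<longleftrightarrow>
     (\<forall>x. V (- x) = V x) \<and> antimono_on {0<..} V \<and>
     integrable lborel V \<and> integrable lborel (\<lambda>x. \<bar>x\<bar> * V x) \<and>
     (\<forall>\<omega>. fourier V \<omega> \<in> \<real> \<and> 0 < Re (fourier V \<omega>)) \<and>
     sobolev_infinity 2 (\<lambda>\<omega>. sqrt (Re (fourier V \<omega>))) \<and>
     (\<exists>W :: nat \<Rightarrow> real \<Rightarrow> real.
        (\<forall>k. continuous_on UNIV (W k) \<and> bounded (range (W k)) \<and> integrable lborel (W k) \<and>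
             (\<forall>\<omega>. fourier (W k) \<omega> \<in> \<real> \<and> 0 \<le> Re (fourier (W k) \<omega>))) \<and>
        (AE x in lborel. incseq (\<lambda>k. W k x) \<and> (\<lambda>k. W k x) \<longlonglongrightarrow> V x) \<and>
        (\<lambda>k. \<integral>x. \<bar>V x - W k x\<bar> \<partial>lborel) \<longlonglongrightarrow> 0)"

text \<open>An admissible potential is even, and decreasing and integrable on \<open>(0,\<infinity>)\<close>, hence
  nonnegative away from \<open>0\<close>; so \<open>ennreal\<close> truncates nothing and the limit exists.\<close>

definition pot_ext :: "(real \<Rightarrow> real) \<Rightarrow> real \<Rightarrow> ennreal" where
  "pot_ext V x = (if x = 0 then Lim (at_right 0) (\<lambda>t. ennreal (V t)) else ennreal (V x))"

definition prob_halfline :: "real measure set" where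
  "prob_halfline = {\<mu>. prob_space \<mu> \<and> sets \<mu> = sets (restrict_space borel {0..})}"

definition narrow_conv :: "('i \<Rightarrow> real measure) \<Rightarrow> real measure \<Rightarrow> 'i filter \<Rightarrow> bool" where
  "narrow_conv m \<mu> F \<longleftrightarrow>
     (\<forall>f :: real \<Rightarrow> real. continuous_on {0..} f \<longrightarrow> bounded (f ` {0..}) \<longrightarrow>
        ((\<lambda>i. \<integral>x. f x \<partial>m i) \<longlongrightarrow> (\<integral>x. f x \<partial>\<mu>)) F)"

definition narrow_Gamma_limit ::
    "(real \<Rightarrow> real measure \<Rightarrow> ennreal) \<Rightarrow> (real measure \<Rightarrow> ennreal) \<Rightarrow> bool" where
  "narrow_Gamma_limit E E\<^sub>0 \<longleftrightarrow>
     (\<forall>\<mu>\<in>prob_halfline. \<forall>m. (\<forall>\<gamma>>0. m \<gamma> \<in> prob_halfline) \<longrightarrow> narrow_conv m \<mu> at_top \<longrightarrow>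
        E\<^sub>0 \<mu> \<le> Liminf at_top (\<lambda>\<gamma>. E \<gamma> (m \<gamma>))) \<and>
     (\<forall>\<mu>\<in>prob_halfline. \<exists>m. (\<forall>\<gamma>>0. m \<gamma> \<in> prob_halfline) \<and> narrow_conv m \<mu> at_top \<and>
        Limsup at_top (\<lambda>\<gamma>. E \<gamma> (m \<gamma>)) \<le> E\<^sub>0 \<mu>)"

definition energy :: "(real \<Rightarrow> real) \<Rightarrow> real \<Rightarrow> real measure \<Rightarrow> ennreal" where
  "energy V \<gamma> \<mu> =
     ennreal (1 / 2 * \<gamma>) * (\<integral>\<^sup>+y. (\<integral>\<^sup>+x. pot_ext V (\<gamma> * (x - y)) \<partial>\<mu>) \<partial>\<mu>) + (\<integral>\<^sup>+x. ennreal x \<partial>\<mu>)"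

text \<open>When a Lebesgue density of \<open>\<mu>\<close> exists, \<open>RN_deriv\<close> is one, and it is unique
  up to null sets.\<close>

definition limit_energy :: "real \<Rightarrow> real measure \<Rightarrow> ennreal" where
  "limit_energy a \<mu> =
     (let L = restrict_space lborel {0..}; \<rho> = RN_deriv L \<mu>
      in if \<exists>f\<in>borel_measurable L. \<mu> = density L f
         then ennreal a * (\<integral>\<^sup>+x. (\<rho> x)\<^sup>2 \<partial>L) + (\<integral>\<^sup>+x. ennreal x * \<rho> x \<partial>L)
         else \<infinity>)"

end

theory Submission
  imports Defs
begin

text \<open>
  The recovery sequence is constant: by \<open>2 \<rho>(x) \<rho>(y) \<le> \<rho>(x)\<^sup>2 + \<rho>(y)\<^sup>2\<close> the interaction energy of a density is
  at most \<open>a \<integral> \<rho>\<^sup>2\<close> for every \<open>\<gamma>\<close>. For the lower bound, replace \<open>V\<close> by one of the continuous positive definite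
  kernels \<open>W \<le> V\<close>, write \<open>W\<^sub>\<gamma>(x) = \<gamma> W(\<gamma> x)\<close>, and test positive definiteness on the signed measure
  \<open>\<mu>\<^sub>\<gamma> - g dx\<close> with \<open>g \<ge> 0\<close> continuous of compact support. Since \<open>W\<^sub>\<gamma>\<close> converges to \<open>(\<integral> W) \<delta>\<close>, the energies are
  asymptotically at least \<open>1/2 (\<integral> W) (2 \<integral> g d\<mu> - \<integral> g\<^sup>2)\<close> plus the truncated first moment. Exhausting \<open>V\<close> by such \<open>W\<close>
  replaces \<open>1/2 \<integral> W\<close> by \<open>a\<close>; the supremum over \<open>g\<close> is finite only if \<open>\<mu>\<close> has a density in \<open>L\<^sup>2\<close>, and is then
  \<open>\<integral> \<rho>\<^sup>2\<close>. Compactness is tightness by the bound on the first moment.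
\<close>

section \<open>Gaussian regularisation\<close>

text \<open>The measures \<mu>_\<gamma> may have atoms while V(0) may be infinite, so for V itself
  the energy of the signed measure can read infinity minus infinity. With a bounded kernel all four
  terms of its expansion are finite. Nothing is known about the limit of the self-energy of
  \<mu>_\<gamma>, and it is the term to be bounded; each of the other three contains g, which is
  fixed before \<gamma> grows and is therefore almost constant at the scale 1/\<gamma> of the
  kernel. Hence they converge, although \<mu>_\<gamma> has no regularity of its own. The expression
  in g is convex duality for the squared L^2 norm: 2 g \<rho> - g^2 is largest at g = \<rho>. The
  first moment is truncated because x is unbounded and so no test function for narrow
  convergence.\<close>

lemma std_normal_fourier:
  "(\<integral>u. complex_of_real (std_normal_density u) * cis (t * u) \<partial>lborel) = complex_of_real (exp (- t\<^sup>2 / 2))"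
proof -
  have "char std_normal_distribution t = (\<integral>u. std_normal_density u *\<^sub>R iexp (t * u) \<partial>lborel)"
    unfolding char_def by (rule integral_density) auto
  then show ?thesis
    by (simp add: char_std_normal_distribution scaleR_conv_of_real cis_conv_exp)
qed

lemma integrable_std_normal_density: "integrable lborel std_normal_density"
  using integrable_normal_moment[of 1 0 0] by simp

lemma fourier_cis:
  "fourier f \<omega> = (\<integral>x. complex_of_real (f x) * cis (- (2 * pi * x * \<omega>)) \<partial>lborel)"
  unfolding fourier_def cis_conv_exp by (intro Bochner_Integration.integral_cong) (auto simp: algebra_simps)

text \<open>The substitution u = 2 pi c w in the characteristic function of the standard normal law
  at s / c. The weight is scaled so that the result is the centred normal density of standard
  deviation c, an approximate identity as c tends to 0.\<close>

lemma gaussian_weight_fourier: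
  fixes c :: real
  assumes c: "c > 0"
  shows "(\<integral>w. complex_of_real (exp (- (2 * pi * c * w)\<^sup>2 / 2)) * cis (2 * pi * w * s) \<partial>lborel)
     = complex_of_real (std_normal_density (s / c) / c)"
proof -
  have *: "2 * pi * c \<noteq> 0" using c by auto
  have e: "exp (- u\<^sup>2 / 2) = sqrt (2 * pi) * std_normal_density u" for u :: real
    by (simp add: std_normal_density_def)
  have "complex_of_real (exp (- (s / c)\<^sup>2 / 2)) =
      (\<integral>u. complex_of_real (std_normal_density u) * cis (s / c * u) \<partial>lborel)"
    by (rule std_normal_fourier[symmetric])
  also have "\<dots> = \<bar>2 * pi * c\<bar> *\<^sub>R (\<integral>w. complex_of_real (std_normal_density (0 + 2 * pi * c * w)) * cis (s / c * (0 + 2 * pi * c * w)) \<partial>lborel)"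
    using * by (rule lborel_integral_real_affine)
  also have "(\<integral>w. complex_of_real (std_normal_density (0 + 2 * pi * c * w)) * cis (s / c * (0 + 2 * pi * c * w)) \<partial>lborel)
     = (\<integral>w. complex_of_real (1 / sqrt (2 * pi)) * (complex_of_real (exp (- (2 * pi * c * w)\<^sup>2 / 2)) * cis (2 * pi * w * s)) \<partial>lborel)"
  proof (intro Bochner_Integration.integral_cong refl)
    fix w
    have "std_normal_density (0 + 2 * pi * c * w) = 1 / sqrt (2 * pi) * exp (- (2 * pi * c * w)\<^sup>2 / 2)"
      by (simp add: std_normal_density_def)
    moreover have "s / c * (0 + 2 * pi * c * w) = 2 * pi * w * s" using c by simp
    ultimately show "complex_of_real (std_normal_density (0 + 2 * pi * c * w)) * cis (s / c * (0 + 2 * pi * c * w))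
      = complex_of_real (1 / sqrt (2 * pi)) * (complex_of_real (exp (- (2 * pi * c * w)\<^sup>2 / 2)) * cis (2 * pi * w * s))"
      by (simp only: of_real_mult mult.assoc)
  qed
  finally have "complex_of_real (exp (- (s / c)\<^sup>2 / 2)) = complex_of_real (2 * pi * c / sqrt (2 * pi)) *
      (\<integral>w. complex_of_real (exp (- (2 * pi * c * w)\<^sup>2 / 2)) * cis (2 * pi * w * s) \<partial>lborel)"
    using c by (simp add: scaleR_conv_of_real)
  then have "(\<integral>w. complex_of_real (exp (- (2 * pi * c * w)\<^sup>2 / 2)) * cis (2 * pi * w * s) \<partial>lborel)
     = complex_of_real (exp (- (s / c)\<^sup>2 / 2)) / complex_of_real (2 * pi * c / sqrt (2 * pi))"
    using c by (simp add: field_simps)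
  also have "\<dots> = complex_of_real (exp (- (s / c)\<^sup>2 / 2) / (2 * pi * c / sqrt (2 * pi)))"
    by simp
  also have "exp (- (s / c)\<^sup>2 / 2) / (2 * pi * c / sqrt (2 * pi)) = std_normal_density (s / c) / c"
    unfolding e using c by (simp add: field_simps)
  finally show ?thesis .
qed

lemma integrable_gaussian_weight:
  assumes "c > 0"
  shows "integrable lborel (\<lambda>w::real. exp (- (2 * pi * c * w)\<^sup>2 / 2))"
proof -
  have "integrable lborel (\<lambda>w. sqrt (2 * pi) * std_normal_density (0 + 2 * pi * c * w))"
    using assms by (intro integrable_mult_right lborel_integrable_real_affine integrable_std_normal_density) auto
  then show ?thesis by (simp add: std_normal_density_def)
qed

lemma borel_measurable_cis [measurable]: "cis \<in> borel_measurable borel"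
  by (intro borel_measurable_continuous_onI continuous_intros)

text \<open>Supplies the integrability behind every Fubini exchange of Bochner integrals below.
  Typically one factor is the integrable kernel or its transform, and the other a constant on a
  finite measure.\<close>

lemma integrable_pair_bound:
  fixes f :: "'a \<times> 'b \<Rightarrow> 'c::{banach, second_countable_topology}" and p :: "'a \<Rightarrow> real" and q :: "'b \<Rightarrow> real"
  assumes "sigma_finite_measure M" "sigma_finite_measure N"
  assumes [measurable]: "f \<in> borel_measurable (M \<Otimes>\<^sub>M N)"
    and p: "integrable M p" and q: "integrable N q"
    and b: "\<And>x y. norm (f (x, y)) \<le> norm (p x * q y)"
  shows "integrable (M \<Otimes>\<^sub>M N) f"
proof -
  interpret M: sigma_finite_measure M by fact
  interpret N: sigma_finite_measure N by fact
  interpret pair_sigma_finite M N ..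
  have [measurable]: "p \<in> borel_measurable M" "q \<in> borel_measurable N" using p q by auto
  have "integrable (M \<Otimes>\<^sub>M N) (\<lambda>(x, y). p x * q y)"
  proof (rule Fubini_integrable)
    show "integrable M (\<lambda>x. \<integral>y. norm (case (x, y) of (x, y) \<Rightarrow> p x * q y) \<partial>N)"
      using integrable_norm[OF p] by (simp add: abs_mult)
  qed (use q in auto)
  then show ?thesis
    by (rule Bochner_Integration.integrable_bound) (use b in auto)
qed

text \<open>Fourier inversion for the convolution of W with a normal density of standard deviation
  c. The Gaussian weight provides the integrability in w that Fubini needs, so nothing is asked of
  the transform of W.\<close>

lemma gaussian_regularisation:
  fixes W :: "real \<Rightarrow> real"
  assumes W: "integrable lborel W" and c: "c > 0"
  shows "(\<integral>w. fourier W w * complex_of_real (exp (- (2 * pi * c * w)\<^sup>2 / 2)) * cis (2 * pi * w * z) \<partial>lborel)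
    = complex_of_real (\<integral>v. W (z + c * v) * std_normal_density v \<partial>lborel)"
proof -
  have [measurable]: "W \<in> borel_measurable borel" using W by auto
  let ?G = "\<lambda>w. exp (- (2 * pi * c * w)\<^sup>2 / 2)"
  let ?h = "\<lambda>x w. complex_of_real (W x) * (complex_of_real (?G w) * cis (2 * pi * w * (z - x)))"
  have int: "integrable (lborel \<Otimes>\<^sub>M lborel) (case_prod ?h)"
    by (rule integrable_pair_bound[OF _ _ _ W integrable_gaussian_weight[OF c]])
       (auto intro: sigma_finite_lborel simp: norm_mult)
  have "(\<integral>w. fourier W w * complex_of_real (?G w) * cis (2 * pi * w * z) \<partial>lborel)
      = (\<integral>w. (\<integral>x. ?h x w \<partial>lborel) \<partial>lborel)"
  proof (intro Bochner_Integration.integral_cong refl)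
    fix w
    have "fourier W w * complex_of_real (?G w) * cis (2 * pi * w * z)
      = (\<integral>x. complex_of_real (W x) * cis (- (2 * pi * x * w)) * (complex_of_real (?G w) * cis (2 * pi * w * z)) \<partial>lborel)"
      unfolding fourier_cis by simp
    also have "\<dots> = (\<integral>x. ?h x w \<partial>lborel)"
    proof (intro Bochner_Integration.integral_cong refl)
      fix x
      have "cis (2 * pi * w * (z - x)) = cis (- (2 * pi * x * w)) * cis (2 * pi * w * z)"
        by (simp add: cis_mult algebra_simps)
      then show "complex_of_real (W x) * cis (- (2 * pi * x * w)) * (complex_of_real (?G w) * cis (2 * pi * w * z)) = ?h x w"
        by simp
    qed
    finally show "fourier W w * complex_of_real (?G w) * cis (2 * pi * w * z) = (\<integral>x. ?h x w \<partial>lborel)" .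
  qed
  also have "\<dots> = (\<integral>x. (\<integral>w. ?h x w \<partial>lborel) \<partial>lborel)"
    by (rule lborel_pair.Fubini_integral[OF int])
  also have "\<dots> = (\<integral>x. complex_of_real (W x * (std_normal_density ((z - x) / c) / c)) \<partial>lborel)"
    by (simp only: integral_mult_right_zero gaussian_weight_fourier[OF c] of_real_mult)
  also have "\<dots> = complex_of_real (\<integral>x. W x * (std_normal_density ((z - x) / c) / c) \<partial>lborel)"
    by (rule integral_complex_of_real)
  \<comment> \<open>Substituting x = z + c v removes c from the density and leaves it only in the
    argument of W, the form suited to dominated convergence as c tends to 0.\<close>
  also have "(\<integral>x. W x * (std_normal_density ((z - x) / c) / c) \<partial>lborel)
     = c * (\<integral>v. W (z + c * v) * (std_normal_density ((z - (z + c * v)) / c) / c) \<partial>lborel)"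
    using c by (subst lborel_integral_real_affine[where c = c and t = z]) auto
  also have "\<dots> = (\<integral>v. c * (W (z + c * v) * (std_normal_density ((z - (z + c * v)) / c) / c)) \<partial>lborel)"
    by simp
  also have "\<dots> = (\<integral>v. W (z + c * v) * std_normal_density v \<partial>lborel)"
    using c by (intro Bochner_Integration.integral_cong) (auto simp: std_normal_density_def)
  finally show ?thesis .
qed

section \<open>Positive definiteness of the interaction\<close>

text \<open>Bilinear in two positive measures: the signed measure of the argument is never formed,
  and its quadratic form appears expanded into four such terms.\<close>

definition interaction :: "(real \<Rightarrow> real) \<Rightarrow> real measure \<Rightarrow> real measure \<Rightarrow> real" where
  "interaction W M N = (\<integral>y. (\<integral>x. W (x - y) \<partial>M) \<partial>N)"

text \<open>The sign in the exponent is opposite to that of \<open>fourier\<close>, as in the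
  inversion formula \<open>gaussian_regularisation\<close>.\<close>

definition ft_measure :: "real measure \<Rightarrow> real \<Rightarrow> complex" where
  "ft_measure M w = (\<integral>x. cis (2 * pi * w * x) \<partial>M)"

lemma borel_measurable_cnj [measurable]: "cnj \<in> borel_measurable borel"
  by (intro borel_measurable_continuous_onI continuous_intros)

lemma norm_ft_measure_le:
  assumes "finite_measure M" "sets M = sets borel"
  shows "norm (ft_measure M w) \<le> measure M (space M)"
proof -
  interpret finite_measure M by fact
  have "norm (ft_measure M w) \<le> (\<integral>x. norm (cis (2 * pi * w * x)) \<partial>M)"
    unfolding ft_measure_def by (rule integral_norm_bound)
  then show ?thesis by simp
qed

lemma ft_measure_measurable:
  assumes "finite_measure M" "sets M = sets borel"
  shows "ft_measure M \<in> borel_measurable borel"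
proof -
  interpret finite_measure M by fact
  have [measurable_cong]: "sets M = sets borel" by fact
  show ?thesis unfolding ft_measure_def by measurable
qed

lemma integrable_bounded_finite:
  fixes f :: "real \<Rightarrow> 'b::{banach, second_countable_topology}"
  assumes "finite_measure M" "f \<in> borel_measurable M" "\<And>x. norm (f x) \<le> B"
  shows "integrable M f"
proof -
  interpret finite_measure M by fact
  show ?thesis by (rule integrable_const_bound[of _ B]) (use assms in auto)
qed

text \<open>Parseval's identity for the kernel U with integrable transform h:
  \<open>cis (2 * pi * w * (x - y))\<close> splits into a factor in x and the conjugate of a factor
  in y.\<close>

lemma interaction_fourier:
  fixes h :: "real \<Rightarrow> complex"
  assumes M: "finite_measure M" "sets M = sets borel" and N: "finite_measure N" "sets N = sets borel"
    and h: "integrable lborel h"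
    and U: "\<And>z. (\<integral>w. h w * cis (2 * pi * w * z) \<partial>lborel) = complex_of_real (U z)"
  shows "(\<integral>w. h w * (ft_measure M w * cnj (ft_measure N w)) \<partial>lborel) = complex_of_real (interaction U M N)"
proof -
  interpret M: finite_measure M by fact
  interpret N: finite_measure N by fact
  have [measurable_cong]: "sets M = sets borel" "sets N = sets borel" by fact+
  have [measurable]: "h \<in> borel_measurable borel" using h by auto
  have [measurable]: "ft_measure M \<in> borel_measurable borel" using ft_measure_measurable M by auto
  have nh: "integrable lborel (\<lambda>w. norm (h w))" using h by auto
  have one: "integrable N (\<lambda>_. 1::real)" "integrable M (\<lambda>_. 1::real)" by auto
  interpret LN: pair_sigma_finite lborel N
    by (intro pair_sigma_finite.intro sigma_finite_lborel N.sigma_finite_measure_axioms)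
  interpret LM: pair_sigma_finite lborel M
    by (intro pair_sigma_finite.intro sigma_finite_lborel M.sigma_finite_measure_axioms)
  have cnjN: "cnj (ft_measure N w) = (\<integral>y. cis (- (2 * pi * w * y)) \<partial>N)" for w
    unfolding ft_measure_def by (simp add: cis_cnj flip: Bochner_Integration.integral_cnj)
  have nhM: "integrable lborel (\<lambda>w. norm (h w) * measure M (space M))" using nh by auto
  \<comment> \<open>The triple integral is exchanged one variable at a time; in this first exchange
    the transform of M is merely a factor bounded by the mass of M.\<close>
  have i1: "integrable (lborel \<Otimes>\<^sub>M N) (case_prod (\<lambda>w y. h w * ft_measure M w * cis (- (2 * pi * w * y))))"
    by (rule integrable_pair_bound[OF _ _ _ nhM one(1)])
       (auto intro: sigma_finite_lborel N.sigma_finite_measure_axioms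
          intro!: mult_left_mono norm_ft_measure_le M simp: norm_mult)
  have i2: "integrable (lborel \<Otimes>\<^sub>M M) (case_prod (\<lambda>w x. h w * cis (2 * pi * w * (x - y))))" for y
    by (rule integrable_pair_bound[OF _ _ _ nh one(2)])
       (auto intro: sigma_finite_lborel M.sigma_finite_measure_axioms simp: norm_mult)
  have "(\<integral>w. h w * (ft_measure M w * cnj (ft_measure N w)) \<partial>lborel)
     = (\<integral>w. (\<integral>y. h w * ft_measure M w * cis (- (2 * pi * w * y)) \<partial>N) \<partial>lborel)"
    by (simp add: cnjN mult.assoc)
  also have "\<dots> = (\<integral>y. (\<integral>w. h w * ft_measure M w * cis (- (2 * pi * w * y)) \<partial>lborel) \<partial>N)"
    using LN.Fubini_integral[OF i1] by simp
  also have "\<dots> = (\<integral>y. (\<integral>w. (\<integral>x. h w * cis (2 * pi * w * (x - y)) \<partial>M) \<partial>lborel) \<partial>N)"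
  proof (intro Bochner_Integration.integral_cong refl)
    fix y w
    have "h w * ft_measure M w * cis (- (2 * pi * w * y))
       = (\<integral>x. h w * (cis (2 * pi * w * x) * cis (- (2 * pi * w * y))) \<partial>M)"
      unfolding ft_measure_def by simp
    also have "\<dots> = (\<integral>x. h w * cis (2 * pi * w * (x - y)) \<partial>M)"
      by (simp only: cis_mult) (simp add: algebra_simps)
    finally show "h w * ft_measure M w * cis (- (2 * pi * w * y)) = (\<integral>x. h w * cis (2 * pi * w * (x - y)) \<partial>M)" .
  qed
  also have "\<dots> = (\<integral>y. (\<integral>x. (\<integral>w. h w * cis (2 * pi * w * (x - y)) \<partial>lborel) \<partial>M) \<partial>N)"
    using LM.Fubini_integral[OF i2] by simp
  also have "\<dots> = complex_of_real (interaction U M N)"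
    unfolding U interaction_def by simp
  finally show ?thesis .
qed

lemma interaction_tendsto:
  assumes M: "finite_measure M" "sets M = sets borel" and N: "finite_measure N" "sets N = sets borel"
    and [measurable]: "\<And>n::nat. U n \<in> borel_measurable borel" "W \<in> borel_measurable borel"
    and B: "\<And>n z. \<bar>U n z\<bar> \<le> B" and lim: "\<And>z. (\<lambda>n. U n z) \<longlonglongrightarrow> W z"
  shows "(\<lambda>n. interaction (U n) M N) \<longlonglongrightarrow> interaction W M N"
proof -
  interpret M: finite_measure M by fact
  interpret N: finite_measure N by fact
  have [measurable_cong]: "sets M = sets borel" "sets N = sets borel" by fact+
  have iU: "integrable M (\<lambda>x. U n (x - y))" for n y
    by (rule integrable_bounded_finite[OF M(1), of _ B]) (use B in auto)
  have inner: "(\<lambda>n. \<integral>x. U n (x - y) \<partial>M) \<longlonglongrightarrow> (\<integral>x. W (x - y) \<partial>M)" for y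
    by (rule integral_dominated_convergence[where w = "\<lambda>_. B"]) (use B lim in auto)
  have bd: "\<bar>\<integral>x. U n (x - y) \<partial>M\<bar> \<le> B * measure M (space M)" for n y
  proof -
    have "\<bar>\<integral>x. U n (x - y) \<partial>M\<bar> \<le> (\<integral>x. \<bar>U n (x - y)\<bar> \<partial>M)" by (rule integral_abs_bound)
    also have "\<dots> \<le> (\<integral>x. B \<partial>M)" using iU B by (intro integral_mono) auto
    finally show ?thesis by (simp add: mult.commute)
  qed
  show ?thesis unfolding interaction_def
    by (rule integral_dominated_convergence[where w = "\<lambda>_. B * measure M (space M)"]) (use inner bd in auto)
qed

lemma norm_fourier_le: 
  "norm (fourier W w) \<le> (\<integral>x. \<bar>W x\<bar> \<partial>lborel)"
proof -
  have "norm (fourier W w) \<le> (\<integral>x. norm (complex_of_real (W x) * cis (- (2 * pi * x * w))) \<partial>lborel)"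
    unfolding fourier_cis by (rule integral_norm_bound)
  then show ?thesis by (simp add: norm_mult)
qed

lemma fourier_measurable:
  assumes "W \<in> borel_measurable borel"
  shows "fourier W \<in> borel_measurable borel"
proof -
  have [measurable]: "W \<in> borel_measurable borel" by fact
  show ?thesis unfolding fourier_cis[abs_def] by measurable
qed

text \<open>The kernel \<open>W\<close> is only continuous, so Fourier inversion is applied to its Gaussian
  regularisations, whose Fourier transforms are integrable.\<close>

lemma interaction_pos_def:
  fixes W :: "real \<Rightarrow> real"
  assumes M: "finite_measure M" "sets M = sets borel" and N: "finite_measure N" "sets N = sets borel"
    and cont: "continuous_on UNIV W" and B: "\<And>z. \<bar>W z\<bar> \<le> B" and W: "integrable lborel W"
    and pos: "\<And>w. fourier W w \<in> \<real> \<and> 0 \<le> Re (fourier W w)"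
  shows "interaction W M N + interaction W N M \<le> interaction W M M + interaction W N N"
proof -
  define c where "c n = inverse (real (Suc n))" for n
  have c: "c n > 0" for n by (simp add: c_def)
  have c0: "c \<longlonglongrightarrow> 0" unfolding c_def by (rule LIMSEQ_inverse_real_of_nat)
  have [measurable]: "W \<in> borel_measurable borel" using W by auto
  have [measurable]: "fourier W \<in> borel_measurable borel" by (rule fourier_measurable) simp
  have [measurable]: "ft_measure M \<in> borel_measurable borel" "ft_measure N \<in> borel_measurable borel"
    using ft_measure_measurable M N by auto
  define U where "U n z = (\<integral>v. W (z + c n * v) * std_normal_density v \<partial>lborel)" for n z
  define h where "h n w = fourier W w * complex_of_real (exp (- (2 * pi * c n * w)\<^sup>2 / 2))" for n w
  have [measurable]: "U n \<in> borel_measurable borel" for n unfolding U_def by measurable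
  have [measurable]: "h n \<in> borel_measurable borel" for n unfolding h_def by measurable
  have Uh: "(\<integral>w. h n w * cis (2 * pi * w * z) \<partial>lborel) = complex_of_real (U n z)" for n z
    unfolding h_def U_def by (rule gaussian_regularisation[OF W c])
  have h_int: "integrable lborel (h n)" for n
  proof (rule Bochner_Integration.integrable_bound)
    show "integrable lborel (\<lambda>w. (\<integral>x. \<bar>W x\<bar> \<partial>lborel) * exp (- (2 * pi * c n * w)\<^sup>2 / 2))"
      by (intro integrable_mult_right integrable_gaussian_weight c)
    show "AE w in lborel. norm (h n w) \<le> norm ((\<integral>x. \<bar>W x\<bar> \<partial>lborel) * exp (- (2 * pi * c n * w)\<^sup>2 / 2))"
      by (auto simp: h_def norm_mult abs_mult intro!: mult_right_mono order_trans[OF norm_fourier_le])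
  qed simp
  have int_ft: "integrable lborel (\<lambda>w. h n w * (ft_measure P w * cnj (ft_measure Q w)))"
    if P: "finite_measure P" "sets P = sets borel" and Q: "finite_measure Q" "sets Q = sets borel" for n P Q
  proof (rule Bochner_Integration.integrable_bound)
    have [measurable]: "ft_measure P \<in> borel_measurable borel" "ft_measure Q \<in> borel_measurable borel"
      using ft_measure_measurable P Q by auto
    show "(\<lambda>w. h n w * (ft_measure P w * cnj (ft_measure Q w))) \<in> borel_measurable lborel" by measurable
    show "integrable lborel (\<lambda>w. norm (h n w) * (measure P (space P) * measure Q (space Q)))"
      using h_int by auto
    show "AE w in lborel. norm (h n w * (ft_measure P w * cnj (ft_measure Q w)))
        \<le> norm (norm (h n w) * (measure P (space P) * measure Q (space Q)))"
      by (auto simp: norm_mult intro!: mult_left_mono mult_mono norm_ft_measure_le P Q)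
  qed
  have step: "interaction (U n) M N + interaction (U n) N M \<le> interaction (U n) M M + interaction (U n) N N" for n
  proof -
    let ?F = "ft_measure M" and ?G = "ft_measure N"
    have "complex_of_real (interaction (U n) M M + interaction (U n) N N - interaction (U n) M N - interaction (U n) N M)
      = (\<integral>w. h n w * (?F w * cnj (?F w)) \<partial>lborel) + (\<integral>w. h n w * (?G w * cnj (?G w)) \<partial>lborel)
        - (\<integral>w. h n w * (?F w * cnj (?G w)) \<partial>lborel) - (\<integral>w. h n w * (?G w * cnj (?F w)) \<partial>lborel)"
      by (simp add: interaction_fourier[OF _ _ _ _ h_int Uh] M N)
    also have "\<dots> = (\<integral>w. h n w * (?F w * cnj (?F w)) + h n w * (?G w * cnj (?G w))
        - h n w * (?F w * cnj (?G w)) - h n w * (?G w * cnj (?F w)) \<partial>lborel)"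
      by (simp add: int_ft M N del: complex_cnj_mult)
    \<comment> \<open>The four products combine into the squared modulus of
      \<open>?F w - ?G w\<close>. This is the only place where the signed measure shows up, as a
      difference of transforms; its weight is real and nonnegative by \<open>pos\<close>.\<close>
    also have "\<dots> = (\<integral>w. complex_of_real (Re (fourier W w) * exp (- (2 * pi * c n * w)\<^sup>2 / 2) * (cmod (?F w - ?G w))\<^sup>2) \<partial>lborel)"
    proof (intro Bochner_Integration.integral_cong refl)
      fix w
      have "h n w = complex_of_real (Re (fourier W w) * exp (- (2 * pi * c n * w)\<^sup>2 / 2))"
        using pos[of w] by (simp add: h_def of_real_Re)
      moreover have "h n w * (?F w * cnj (?F w)) + h n w * (?G w * cnj (?G w))
        - h n w * (?F w * cnj (?G w)) - h n w * (?G w * cnj (?F w)) = h n w * ((?F w - ?G w) * cnj (?F w - ?G w))"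
        by (simp add: algebra_simps)
      moreover have "(?F w - ?G w) * cnj (?F w - ?G w) = complex_of_real ((cmod (?F w - ?G w))\<^sup>2)"
        by (rule complex_norm_square[symmetric])
      ultimately show "h n w * (?F w * cnj (?F w)) + h n w * (?G w * cnj (?G w))
        - h n w * (?F w * cnj (?G w)) - h n w * (?G w * cnj (?F w))
        = complex_of_real (Re (fourier W w) * exp (- (2 * pi * c n * w)\<^sup>2 / 2) * (cmod (?F w - ?G w))\<^sup>2)"
        by (simp only: of_real_mult)
    qed
    also have "\<dots> = complex_of_real (\<integral>w. Re (fourier W w) * exp (- (2 * pi * c n * w)\<^sup>2 / 2) * (cmod (?F w - ?G w))\<^sup>2 \<partial>lborel)"
      by (rule integral_complex_of_real)
    finally have "interaction (U n) M M + interaction (U n) N N - interaction (U n) M N - interaction (U n) N M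
       = (\<integral>w. Re (fourier W w) * exp (- (2 * pi * c n * w)\<^sup>2 / 2) * (cmod (?F w - ?G w))\<^sup>2 \<partial>lborel)"
      by (simp only: of_real_eq_iff)
    also have "\<dots> \<ge> 0" using pos by (intro integral_nonneg_AE) auto
    finally show ?thesis by simp
  qed
  have UB: "\<bar>U n z\<bar> \<le> B" for n z
  proof -
    have "\<bar>U n z\<bar> \<le> (\<integral>v. \<bar>W (z + c n * v) * std_normal_density v\<bar> \<partial>lborel)"
      unfolding U_def by (rule integral_abs_bound)
    also have "\<dots> \<le> (\<integral>v. B * std_normal_density v \<partial>lborel)"
    proof (rule integral_mono')
      show "integrable lborel (\<lambda>v. B * std_normal_density v)" using integrable_std_normal_density by simp
    qed (use B order_trans[OF abs_ge_zero B] in \<open>auto simp: abs_mult intro!: mult_right_mono\<close>)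
    also have "\<dots> = B" by simp
    finally show ?thesis .
  qed
  have Ulim: "(\<lambda>n. U n z) \<longlonglongrightarrow> W z" for z
  proof -
    have "(\<lambda>n. U n z) \<longlonglongrightarrow> (\<integral>v. W z * std_normal_density v \<partial>lborel)"
      unfolding U_def
    proof (rule integral_dominated_convergence[where w = "\<lambda>v. B * std_normal_density v"])
      show "integrable lborel (\<lambda>v. B * std_normal_density v)" using integrable_std_normal_density by simp
      show "AE v in lborel. (\<lambda>n. W (z + c n * v) * std_normal_density v) \<longlonglongrightarrow> W z * std_normal_density v"
      proof (intro AE_I2 tendsto_mult tendsto_const)
        fix v
        have "(\<lambda>n. z + c n * v) \<longlonglongrightarrow> z + 0 * v" by (intro tendsto_intros c0)
        moreover have "isCont W z" using cont by (simp add: continuous_on_eq_continuous_at)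
        ultimately show "(\<lambda>n. W (z + c n * v)) \<longlonglongrightarrow> W z" using isCont_tendsto_compose[of z W "\<lambda>n. z + c n * v"] by simp
      qed
      show "AE v in lborel. norm (W (z + c n * v) * std_normal_density v) \<le> B * std_normal_density v" for n
        using B by (auto simp: abs_mult intro!: mult_right_mono)
    qed auto
    then show ?thesis by simp
  qed
  have lim: "(\<lambda>n. interaction (U n) P Q) \<longlonglongrightarrow> interaction W P Q"
    if "finite_measure P" "sets P = sets borel" "finite_measure Q" "sets Q = sets borel" for P Q
    by (rule interaction_tendsto[OF that _ _ UB Ulim]) auto
  show ?thesis
    by (rule LIMSEQ_le[OF tendsto_add[OF lim lim] tendsto_add[OF lim lim]]) (use M N step in auto)
qed

text \<open>Heine-Cantor on an interval with margin 1 around the support: of two points closer than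
  1, either both lie in the larger interval or both lie outside the support.\<close>

lemma uniformly_continuous_compact_support:
  fixes g :: "real \<Rightarrow> real"
  assumes cont: "continuous_on UNIV g" and supp: "\<And>x. R < \<bar>x\<bar> \<Longrightarrow> g x = 0"
  shows "uniformly_continuous_on UNIV g"
proof -
  have uc: "uniformly_continuous_on {-R-1..R+1} g"
    by (intro compact_uniformly_continuous continuous_on_subset[OF cont]) auto
  show ?thesis
    unfolding uniformly_continuous_on_def
  proof (intro allI impI)
    fix e :: real assume e: "e > 0"
    then obtain d where d: "d > 0" "\<And>x y. x \<in> {-R-1..R+1} \<Longrightarrow> y \<in> {-R-1..R+1} \<Longrightarrow> dist y x < d \<Longrightarrow> dist (g y) (g x) < e"
      using uc unfolding uniformly_continuous_on_def by metis
    have "dist (g y) (g x) < e" if "dist y x < min d 1" for x y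
    proof (cases "x \<in> {-R-1..R+1} \<and> y \<in> {-R-1..R+1}")
      case True
      then show ?thesis using d(2)[of x y] that by auto
    next
      case False
      then have "R < \<bar>x\<bar>" "R < \<bar>y\<bar>" using that by (auto simp: dist_real_def)
      then show ?thesis using supp e by simp
    qed
    then show "\<exists>d>0. \<forall>x\<in>UNIV. \<forall>x'\<in>UNIV. dist x' x < d \<longrightarrow> dist (g x') (g x) < e"
      using d(1) by (intro exI[of _ "min d 1"]) auto
  qed
qed

text \<open>The approximating kernels are not assumed to be even, so exchanging the two measures
  reflects the kernel.\<close>

lemma interaction_swap:
  assumes M: "finite_measure M" "sets M = sets borel" and N: "finite_measure N" "sets N = sets borel"
    and [measurable]: "W \<in> borel_measurable borel" and B: "\<And>z. \<bar>W z\<bar> \<le> B"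
  shows "interaction W M N = interaction (\<lambda>z. W (- z)) N M"
proof -
  interpret M: finite_measure M by fact
  interpret N: finite_measure N by fact
  have [measurable_cong]: "sets M = sets borel" "sets N = sets borel" by fact+
  interpret pair_sigma_finite M N
    by (intro pair_sigma_finite.intro N.sigma_finite_measure_axioms M.sigma_finite_measure_axioms)
  have one: "integrable N (\<lambda>_. 1::real)" "integrable M (\<lambda>_. B)" by auto
  have "integrable (M \<Otimes>\<^sub>M N) (\<lambda>(x, y). W (x - y))"
    by (rule integrable_pair_bound[OF _ _ _ one(2,1)])
      (use order_trans[OF B abs_ge_self] in \<open>auto intro: N.sigma_finite_measure_axioms M.sigma_finite_measure_axioms\<close>)
  from Fubini_integral[OF this] show ?thesis
    by (simp add: interaction_def)
qed

text \<open>Moves the dilation from the kernel to the measures, so that positive definiteness of W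
  alone serves all \<gamma> and no transform of a dilated kernel is computed.\<close>

lemma interaction_scale:
  assumes M: "finite_measure M" "sets M = sets borel" and N: "sets N = sets borel"
    and [measurable]: "W \<in> borel_measurable borel"
  shows "interaction (\<lambda>z. W (c * z)) M N = interaction W (distr M borel ((*) c)) (distr N borel ((*) c))"
proof -
  interpret M: finite_measure M by fact
  have [measurable_cong]: "sets M = sets borel" "sets N = sets borel" by fact+
  show ?thesis
    unfolding interaction_def by (simp add: integral_distr right_diff_distrib)
qed

section \<open>Concentrating kernels\<close>

text \<open>The substitution u = \<gamma> (x - y) moves the concentration from the kernel into a
  shift of g by u / \<gamma>. Uniform continuity makes the shift harmless uniformly over all
  measures of mass at most K, and the integral over u passes to the limit by dominated convergence.
  Only the mass of \<open>m \<gamma>\<close> and its integral of g matter, so the constant family g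
  dx is covered too.\<close>

lemma scaled_interaction_tendsto:
  fixes W g :: "real \<Rightarrow> real" and m :: "real \<Rightarrow> real measure"
  assumes W: "integrable lborel W"
    and uc: "uniformly_continuous_on UNIV g" and g0: "\<And>x. 0 \<le> g x" and gB: "\<And>x. g x \<le> B"
    and fm: "\<And>\<gamma>. finite_measure (m \<gamma>)" and sm: "\<And>\<gamma>. sets (m \<gamma>) = sets borel"
    and mK: "\<And>\<gamma>. measure (m \<gamma>) (space (m \<gamma>)) \<le> K"
    and lim: "((\<lambda>\<gamma>. \<integral>x. g x \<partial>m \<gamma>) \<longlongrightarrow> l) at_top"
  shows "((\<lambda>\<gamma>. \<gamma> * interaction (\<lambda>z. W (\<gamma> * z)) (density lborel g) (m \<gamma>)) \<longlongrightarrow> (\<integral>x. W x \<partial>lborel) * l) at_top"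
proof -
  have [measurable_cong]: "sets (m \<gamma>) = sets borel" for \<gamma> by fact
  have [measurable]: "W \<in> borel_measurable borel" using W by auto
  have [measurable]: "g \<in> borel_measurable borel"
    using uc by (intro borel_measurable_continuous_onI uniformly_continuous_imp_continuous)
  have B0: "0 \<le> B" using g0[of 0] gB[of 0] by simp
  have K0: "0 \<le> K" using mK[of 0] measure_nonneg order_trans by blast
  have gi: "integrable (m \<gamma>) (\<lambda>y. g (y + c))" for \<gamma> c
    by (rule integrable_bounded_finite[OF fm, of _ _ B]) (use g0 gB in auto)
  have eq: "\<gamma> * interaction (\<lambda>z. W (\<gamma> * z)) (density lborel g) (m \<gamma>)
      = (\<integral>u. W u * (\<integral>y. g (y + u / \<gamma>) \<partial>m \<gamma>) \<partial>lborel)" if \<gamma>: "\<gamma> > 0" for \<gamma>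
  proof -
    interpret finite_measure "m \<gamma>" by (rule fm)
    interpret P: pair_sigma_finite lborel "m \<gamma>"
      by (intro pair_sigma_finite.intro sigma_finite_lborel sigma_finite_measure_axioms)
    have i: "integrable (m \<gamma>) (\<lambda>_. B)" by simp
    have int: "integrable (lborel \<Otimes>\<^sub>M m \<gamma>) (case_prod (\<lambda>u y. W u * g (y + u / \<gamma>)))"
      by (rule integrable_pair_bound[OF _ _ _ W i])
        (use g0 gB B0 in \<open>auto intro!: sigma_finite_lborel sigma_finite_measure_axioms mult_left_mono simp: abs_mult\<close>)
    have "(\<integral>x. W (\<gamma> * (x - y)) \<partial>density lborel g) = (1 / \<gamma>) * (\<integral>u. W u * g (y + u / \<gamma>) \<partial>lborel)" for y
    proof -
      have "(\<integral>x. W (\<gamma> * (x - y)) \<partial>density lborel g) = (\<integral>x. g x * W (\<gamma> * (x - y)) \<partial>lborel)"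
        using g0 by (subst integral_density) auto
      also have "\<dots> = \<bar>1 / \<gamma>\<bar> *\<^sub>R (\<integral>u. g (y + 1 / \<gamma> * u) * W (\<gamma> * (y + 1 / \<gamma> * u - y)) \<partial>lborel)"
        using \<gamma> by (intro lborel_integral_real_affine) auto
      also have "\<dots> = (1 / \<gamma>) * (\<integral>u. W u * g (y + u / \<gamma>) \<partial>lborel)"
        using \<gamma> by (simp add: mult.commute)
      finally show ?thesis .
    qed
    then have "\<gamma> * interaction (\<lambda>z. W (\<gamma> * z)) (density lborel g) (m \<gamma>)
        = (\<integral>y. (\<integral>u. W u * g (y + u / \<gamma>) \<partial>lborel) \<partial>m \<gamma>)"
      using \<gamma> by (simp add: interaction_def)
    also have "\<dots> = (\<integral>u. (\<integral>y. W u * g (y + u / \<gamma>) \<partial>m \<gamma>) \<partial>lborel)"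
      by (rule P.Fubini_integral[OF int])
    finally show ?thesis by simp
  qed
  have pt: "((\<lambda>\<gamma>. \<integral>y. g (y + u / \<gamma>) \<partial>m \<gamma>) \<longlongrightarrow> l) at_top" for u
  proof -
    have "((\<lambda>\<gamma>. (\<integral>y. g (y + u / \<gamma>) \<partial>m \<gamma>) - (\<integral>y. g y \<partial>m \<gamma>)) \<longlongrightarrow> 0) at_top"
    proof (rule tendstoI)
      fix e :: real assume e: "e > 0"
      \<comment> \<open>The mass bound K may be 0, hence the denominator \<open>K + 1\<close>; the
        total error is then at most \<open>e' * K < e\<close>.\<close>
      define e' where "e' = e / (K + 1)"
      have e': "e' > 0" "e' * K < e" using e K0 by (auto simp: e'_def field_simps)
      obtain d where d: "d > 0" "\<And>x y. dist y x < d \<Longrightarrow> dist (g y) (g x) < e'"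
        using uc e' unfolding uniformly_continuous_on_def by (metis UNIV_I)
      have "((\<lambda>\<gamma>. u / \<gamma>) \<longlongrightarrow> 0) at_top"
        by (intro tendsto_divide_0[OF tendsto_const] filterlim_at_top_imp_at_infinity filterlim_ident)
      from tendstoD[OF this d(1)] show "eventually (\<lambda>\<gamma>. dist ((\<integral>y. g (y + u / \<gamma>) \<partial>m \<gamma>) - (\<integral>y. g y \<partial>m \<gamma>)) 0 < e) at_top"
      proof eventually_elim
        case (elim \<gamma>)
        interpret finite_measure "m \<gamma>" by (rule fm)
        have "\<bar>(\<integral>y. g (y + u / \<gamma>) \<partial>m \<gamma>) - (\<integral>y. g y \<partial>m \<gamma>)\<bar> = \<bar>\<integral>y. g (y + u / \<gamma>) - g y \<partial>m \<gamma>\<bar>"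
          using gi gi[of \<gamma> 0] by simp
        also have "\<dots> \<le> (\<integral>y. \<bar>g (y + u / \<gamma>) - g y\<bar> \<partial>m \<gamma>)" by (rule integral_abs_bound)
        also have "\<dots> \<le> (\<integral>y. e' \<partial>m \<gamma>)"
        proof (rule integral_mono')
          show "\<bar>g (y + u / \<gamma>) - g y\<bar> \<le> e'" for y
            using d(2)[of "y + u / \<gamma>" y] elim by (auto simp: dist_real_def)
        qed (use e' in auto)
        also have "\<dots> = e' * measure (m \<gamma>) (space (m \<gamma>))" by simp
        also have "\<dots> \<le> e' * K" using mK e' by (intro mult_left_mono) auto
        finally show ?case using e' by simp
      qed
    qed
    from tendsto_add[OF this lim] show ?thesis by simp
  qed
  have "((\<lambda>\<gamma>. \<integral>u. W u * (\<integral>y. g (y + u / \<gamma>) \<partial>m \<gamma>) \<partial>lborel) \<longlongrightarrow> (\<integral>u. W u * l \<partial>lborel)) at_top"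
  proof (rule integral_dominated_convergence_at_top[where w = "\<lambda>u. \<bar>W u\<bar> * (B * K)"])
    show "(\<lambda>u. W u * (\<integral>y. g (y + u / \<gamma>) \<partial>m \<gamma>)) \<in> borel_measurable lborel" for \<gamma>
    proof -
      interpret finite_measure "m \<gamma>" by (rule fm)
      show ?thesis by measurable
    qed
    show "\<forall>\<^sub>F \<gamma> in at_top. AE u in lborel. norm (W u * (\<integral>y. g (y + u / \<gamma>) \<partial>m \<gamma>)) \<le> \<bar>W u\<bar> * (B * K)"
    proof (intro always_eventually allI AE_I2)
      fix \<gamma> u
      interpret finite_measure "m \<gamma>" by (rule fm)
      have "\<bar>\<integral>y. g (y + u / \<gamma>) \<partial>m \<gamma>\<bar> = (\<integral>y. g (y + u / \<gamma>) \<partial>m \<gamma>)"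
        using g0 by (intro abs_of_nonneg integral_nonneg_AE) auto
      also have "\<dots> \<le> (\<integral>y. B \<partial>m \<gamma>)" using gi gB by (intro integral_mono) auto
      also have "\<dots> = B * measure (m \<gamma>) (space (m \<gamma>))" by simp
      also have "\<dots> \<le> B * K" using mK B0 by (intro mult_left_mono) auto
      finally show "norm (W u * (\<integral>y. g (y + u / \<gamma>) \<partial>m \<gamma>)) \<le> \<bar>W u\<bar> * (B * K)"
        by (simp add: abs_mult mult_left_mono)
    qed
    show "AE u in lborel. ((\<lambda>\<gamma>. W u * (\<integral>y. g (y + u / \<gamma>) \<partial>m \<gamma>)) \<longlongrightarrow> W u * l) at_top"
      by (intro AE_I2 tendsto_intros pt)
  qed (use W in auto)
  moreover have "\<forall>\<^sub>F \<gamma> in at_top. (\<integral>u. W u * (\<integral>y. g (y + u / \<gamma>) \<partial>m \<gamma>) \<partial>lborel)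
     = \<gamma> * interaction (\<lambda>z. W (\<gamma> * z)) (density lborel g) (m \<gamma>)"
    using eventually_gt_at_top[of 0] by eventually_elim (simp add: eq)
  ultimately show ?thesis by (simp add: tendsto_cong)
qed

section \<open>Upper bound for the interaction energy\<close>

text \<open>A negative value at x persists to the right of x, so the integral of \<bar>V\<bar> would
  exceed every multiple of - V x.\<close>

lemma antimono_integrable_nonneg:
  fixes V :: "real \<Rightarrow> real"
  assumes mono: "antimono_on {0<..} V" and int: "integrable lborel V" and x: "x > 0"
  shows "V x \<ge> 0"
proof (rule ccontr)
  assume "\<not> V x \<ge> 0"
  then have neg: "V x < 0" by simp
  have le: "- V x * real n \<le> (\<integral>y. \<bar>V y\<bar> \<partial>lborel)" for n
  proof -
    have "- V x * real n = (\<integral>y. - V x * indicator {x..x + real n} y \<partial>lborel)" by simp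
    also have "\<dots> \<le> (\<integral>y. \<bar>V y\<bar> \<partial>lborel)"
    proof (rule integral_mono')
      fix y show "- V x * indicator {x..x + real n} y \<le> \<bar>V y\<bar>"
      proof (cases "y \<in> {x..x + real n}")
        case True
        then have "V y \<le> V x" using x by (intro monotone_onD[OF mono]) auto
        then show ?thesis using True neg by simp
      qed simp
    qed (use int in auto)
    finally show ?thesis .
  qed
  obtain n where "(\<integral>y. \<bar>V y\<bar> \<partial>lborel) / (- V x) < real n" using reals_Archimedean2 by blast
  with le[of n] neg show False by (simp add: field_simps)
qed

lemma even_nonneg:
  fixes V :: "real \<Rightarrow> real"
  assumes "antimono_on {0<..} V" "integrable lborel V" "\<And>x. V (- x) = V x" "x \<noteq> 0"
  shows "V x \<ge> 0"
  using antimono_integrable_nonneg[OF assms(1,2), of x] antimono_integrable_nonneg[OF assms(1,2), of "- x"] assms(3,4)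
  by (cases "x > 0") auto

text \<open>Converts the factor 1/2 times the total mass, which the interaction produces, into the
  constant a of the limit energy. The value of V at 0 is ignored as a null set.\<close>

lemma even_integral_half:
  fixes V :: "real \<Rightarrow> real"
  assumes int: "integrable lborel V" and even: "\<And>x. V (- x) = V x"
  shows "(\<integral>x. V x \<partial>lborel) = 2 * (LBINT x:{0<..}. V x)"
proof -
  have i1: "set_integrable lborel {0<..} V" "set_integrable lborel {..<0} V"
    using int by (auto simp: set_integrable_def intro!: integrable_real_mult_indicator simp: mult.commute)
  have "(\<integral>x. V x \<partial>lborel) = (\<integral>x. indicator {0<..} x * V x + indicator {..<0} x * V x \<partial>lborel)"
  proof (rule integral_cong_AE)
    show "AE x in lborel. V x = indicator {0<..} x * V x + indicator {..<0} x * V x"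
      using AE_lborel_singleton[of "0::real"] by eventually_elim (auto simp: indicator_def)
  qed (use int in auto)
  also have "\<dots> = (\<integral>x. indicator {0<..} x * V x \<partial>lborel) + (\<integral>x. indicator {..<0} x * V x \<partial>lborel)"
    using i1 by (intro Bochner_Integration.integral_add) (auto simp: set_integrable_def)
  also have "(\<integral>x. indicator {..<0} x * V x \<partial>lborel) = (\<integral>x. indicator {..<0} (0 + (-1) * x) * V (0 + (-1) * x) \<partial>lborel)"
    by (subst lborel_integral_real_affine[where c = "-1" and t = 0]) auto
  also have "\<dots> = (\<integral>x. indicator {0<..} x * V x \<partial>lborel)"
    using even by (intro Bochner_Integration.integral_cong) (auto simp: indicator_def)
  finally show ?thesis by (simp add: set_lebesgue_integral_def)
qed

lemma ennreal_young: "2 * (a * b) \<le> a\<^sup>2 + (b::ennreal)\<^sup>2"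
proof (cases "a = \<top> \<or> b = \<top>")
  case True
  then show ?thesis by (auto simp: power2_eq_square)
next
  case False
  then obtain x y where "a = ennreal x" "b = ennreal y" "0 \<le> x" "0 \<le> y"
    by (metis ennreal_cases)
  moreover have "2 * (x * y) \<le> x\<^sup>2 + y\<^sup>2" using sum_squares_bound[of x y] by (simp add: mult.assoc)
  ultimately show ?thesis
    by (simp add: ennreal_power ennreal_plus[symmetric] ennreal_mult[symmetric] ennreal_numeral[symmetric]
        del: ennreal_plus ennreal_numeral)
qed

lemma nn_integral_scaled_shift:
  fixes u :: "real \<Rightarrow> ennreal" and \<gamma> :: real
  assumes [measurable]: "u \<in> borel_measurable borel" and "\<gamma> > 0"
  shows "ennreal \<gamma> * (\<integral>\<^sup>+x. u (\<gamma> * (x - y)) \<partial>lborel) = (\<integral>\<^sup>+x. u x \<partial>lborel)"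
    and "ennreal \<gamma> * (\<integral>\<^sup>+y. u (\<gamma> * (x - y)) \<partial>lborel) = (\<integral>\<^sup>+x. u x \<partial>lborel)"
proof -
  show "ennreal \<gamma> * (\<integral>\<^sup>+x. u (\<gamma> * (x - y)) \<partial>lborel) = (\<integral>\<^sup>+x. u x \<partial>lborel)"
    using assms by (subst nn_integral_real_affine[where c = \<gamma> and t = "- \<gamma> * y" and f = u])
      (auto simp: algebra_simps)
  show "ennreal \<gamma> * (\<integral>\<^sup>+y. u (\<gamma> * (x - y)) \<partial>lborel) = (\<integral>\<^sup>+x. u x \<partial>lborel)"
    using assms by (subst nn_integral_real_affine[where c = "- \<gamma>" and t = "\<gamma> * x" and f = u])
      (auto simp: algebra_simps)
qed

text \<open>After Young's inequality each half carries the square of \<rho> in one variable only,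
  and integrating the other variable first gives the mass of u whatever \<gamma> is. Tonelli is
  needed for one of the halves. The factor 2 is kept on both sides and cancelled at the end.\<close>

lemma interaction_upper_bound:
  fixes u \<rho> :: "real \<Rightarrow> ennreal"
  assumes [measurable]: "u \<in> borel_measurable borel" "\<rho> \<in> borel_measurable borel" and \<gamma>: "\<gamma> > 0"
  shows "ennreal \<gamma> * (\<integral>\<^sup>+y. (\<integral>\<^sup>+x. \<rho> x * u (\<gamma> * (x - y)) \<partial>lborel) * \<rho> y \<partial>lborel)
     \<le> (\<integral>\<^sup>+x. u x \<partial>lborel) * (\<integral>\<^sup>+x. (\<rho> x)\<^sup>2 \<partial>lborel)"
proof -
  let ?I = "\<integral>\<^sup>+y. (\<integral>\<^sup>+x. \<rho> x * u (\<gamma> * (x - y)) \<partial>lborel) * \<rho> y \<partial>lborel"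
  let ?U = "\<integral>\<^sup>+x. u x \<partial>lborel" and ?R = "\<integral>\<^sup>+x. (\<rho> x)\<^sup>2 \<partial>lborel"
  have "2 * ?I = (\<integral>\<^sup>+y. (\<integral>\<^sup>+x. 2 * (\<rho> x * \<rho> y) * u (\<gamma> * (x - y)) \<partial>lborel) \<partial>lborel)"
    by (simp add: nn_integral_cmult[symmetric] nn_integral_multc[symmetric] ac_simps)
  also have "\<dots> \<le> (\<integral>\<^sup>+y. (\<integral>\<^sup>+x. ((\<rho> x)\<^sup>2 + (\<rho> y)\<^sup>2) * u (\<gamma> * (x - y)) \<partial>lborel) \<partial>lborel)"
    by (intro nn_integral_mono mult_right_mono ennreal_young) auto
  also have "\<dots> = (\<integral>\<^sup>+y. (\<integral>\<^sup>+x. (\<rho> x)\<^sup>2 * u (\<gamma> * (x - y)) \<partial>lborel) \<partial>lborel)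
      + (\<integral>\<^sup>+y. (\<integral>\<^sup>+x. (\<rho> y)\<^sup>2 * u (\<gamma> * (x - y)) \<partial>lborel) \<partial>lborel)"
    by (simp add: distrib_right nn_integral_add)
  also have "(\<integral>\<^sup>+y. (\<integral>\<^sup>+x. (\<rho> x)\<^sup>2 * u (\<gamma> * (x - y)) \<partial>lborel) \<partial>lborel)
      = (\<integral>\<^sup>+x. (\<integral>\<^sup>+y. (\<rho> x)\<^sup>2 * u (\<gamma> * (x - y)) \<partial>lborel) \<partial>lborel)"
    by (rule lborel_pair.Fubini') simp
  finally have "ennreal \<gamma> * (2 * ?I) \<le> ennreal \<gamma> * ((\<integral>\<^sup>+x. (\<integral>\<^sup>+y. (\<rho> x)\<^sup>2 * u (\<gamma> * (x - y)) \<partial>lborel) \<partial>lborel)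
      + (\<integral>\<^sup>+y. (\<integral>\<^sup>+x. (\<rho> y)\<^sup>2 * u (\<gamma> * (x - y)) \<partial>lborel) \<partial>lborel))"
    by (rule mult_left_mono) simp
  also have "\<dots> = (\<integral>\<^sup>+x. (\<rho> x)\<^sup>2 * (ennreal \<gamma> * (\<integral>\<^sup>+y. u (\<gamma> * (x - y)) \<partial>lborel)) \<partial>lborel)
      + (\<integral>\<^sup>+y. (\<rho> y)\<^sup>2 * (ennreal \<gamma> * (\<integral>\<^sup>+x. u (\<gamma> * (x - y)) \<partial>lborel)) \<partial>lborel)"
    by (simp add: distrib_left nn_integral_cmult ac_simps)
  also have "\<dots> = 2 * (?U * ?R)"
    unfolding nn_integral_scaled_shift[OF assms(1) \<gamma>]
    by (simp add: nn_integral_cmult mult.commute mult_2)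
  finally have "2 * (ennreal \<gamma> * ?I) \<le> 2 * (?U * ?R)" by (simp add: ac_simps)
  then show ?thesis by (simp add: ennreal_mult_le_mult_iff)
qed

section \<open>Densities from a quadratic lower bound\<close>

text \<open>Nonnegativity lets \<open>density lborel g\<close> represent g dx, since
  \<open>ennreal\<close> truncates negative values. Asking for continuity rather than smoothness
  admits distance cutoffs and truncations by \<open>min\<close> and \<open>max\<close>.\<close>

definition bump_function :: "(real \<Rightarrow> real) \<Rightarrow> bool" where
  "bump_function g \<longleftrightarrow> continuous_on UNIV g \<and> (\<forall>x. 0 \<le> g x) \<and> (\<exists>R. \<forall>x. R < \<bar>x\<bar> \<longrightarrow> g x = 0)"

text \<open>Testing with t times continuous approximations of the indicator of K gives, in the
  limit, 2 t M(K) - t^2 |K| \<le> S. As |K| = 0, the linear term alone is bounded for all t \<ge> 0,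
  which forces M(K) = 0.\<close>

lemma L2_bound_null_compact:
  fixes M :: "real measure"
  assumes M: "finite_measure M" "sets M = sets borel"
    and bd: "\<And>g. bump_function g \<Longrightarrow> 2 * (\<integral>x. g x \<partial>M) - (\<integral>x. (g x)\<^sup>2 \<partial>lborel) \<le> S"
    and K: "compact K" "emeasure lborel K = 0"
  shows "emeasure M K = 0"
proof (cases "K = {}")
  case False
  interpret finite_measure M by fact
  have [measurable_cong]: "sets M = sets borel" by fact
  have [measurable]: "K \<in> sets borel" using K by (simp add: borel_compact)
  obtain r where r: "\<And>x. x \<in> K \<Longrightarrow> \<bar>x\<bar> \<le> r"
    using compact_imp_bounded[OF K(1)] unfolding bounded_iff by auto
  \<comment> \<open>A distance cutoff equal to 1 on K and vanishing at distance at least 1/(n+1)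
    from it. It tends to the indicator because K is closed; \<open>infdist\<close> needs K nonempty,
    hence the case split.\<close>
  define c where "c n x = max 0 (1 - real (Suc n) * infdist x K)" for n x
  have c01: "0 \<le> c n x" "c n x \<le> 1" for n x by (auto simp: c_def infdist_nonneg)
  have csupp: "c n x = 0" if "r + 1 < \<bar>x\<bar>" for n x
  proof -
    obtain k where k: "k \<in> K" "infdist x K = dist x k"
      using infdist_attains_inf[of K x] compact_imp_closed[OF K(1)] False by auto
    have "1 \<le> dist x k" using r[OF k(1)] that by (auto simp: dist_real_def)
    then have "1 \<le> real (Suc n) * infdist x K"
      using mult_mono[of 1 "real (Suc n)" 1 "infdist x K"] k by simp
    then show ?thesis by (simp add: c_def)
  qed
  have ccont: "continuous_on UNIV (c n)" for n
    unfolding c_def by (intro continuous_intros)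
  have [measurable]: "c n \<in> borel_measurable borel" for n
    using ccont by (rule borel_measurable_continuous_onI)
  have clim: "(\<lambda>n. c n x) \<longlonglongrightarrow> indicator K x" for x
  proof (cases "x \<in> K")
    case True
    then show ?thesis by (simp add: c_def)
  next
    case nK: False
    have pos: "infdist x K > 0"
      by (rule infdist_pos_not_in_closed[OF compact_imp_closed[OF K(1)] False nK])
    obtain N where N: "1 / infdist x K < real N" using reals_Archimedean2 by blast
    have "c n x = 0" if "n \<ge> N" for n
    proof -
      have "1 / infdist x K < real (Suc n)" using N that by simp
      then show ?thesis using pos by (simp add: c_def field_simps)
    qed
    then have "eventually (\<lambda>n. c n x = 0) sequentially" by (auto simp: eventually_sequentially)
    then show ?thesis using nK by (simp add: tendsto_eventually)
  qed
  have l1: "(\<lambda>n. \<integral>x. c n x \<partial>M) \<longlonglongrightarrow> (\<integral>x. indicator K x \<partial>M)"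
    by (rule integral_dominated_convergence[where w = "\<lambda>_. 1"]) (use c01 clim in auto)
  have l2: "(\<lambda>n. \<integral>x. (c n x)\<^sup>2 \<partial>lborel) \<longlonglongrightarrow> (\<integral>x. (indicator K x)\<^sup>2 \<partial>(lborel::real measure))"
  proof (rule integral_dominated_convergence[where w = "indicator {-(r+1)..r+1}"])
    show "AE x in lborel. norm ((c n x)\<^sup>2) \<le> indicator {-(r+1)..r+1} x" for n
    proof (intro AE_I2)
      fix x show "norm ((c n x)\<^sup>2) \<le> indicator {-(r+1)..r+1} x"
        using csupp[of x n] c01[of n x] by (auto simp: indicator_def power_le_one abs_le_iff)
    qed
    show "integrable lborel (indicator {-(r+1)..r+1} :: real \<Rightarrow> real)"
      by (intro integrable_real_indicator) (auto simp: emeasure_lborel_Icc_eq)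
    show "AE x in lborel. (\<lambda>n. (c n x)\<^sup>2) \<longlonglongrightarrow> (indicator K x)\<^sup>2"
      by (intro AE_I2 tendsto_intros clim)
  qed auto
  have K0: "measure lborel K = 0" using K by (simp add: measure_def)
  have ind2: "(indicator K x)\<^sup>2 = (indicator K x :: real)" for x by (simp add: indicator_def)
  have *: "2 * t * measure M K \<le> S" if t: "t \<ge> 0" for t
  proof -
    have "bump_function (\<lambda>x. t * c n x)" for n
      unfolding bump_function_def using c01 csupp t
      by (auto intro!: continuous_intros ccont exI[of _ "r + 1"])
    from bd[OF this] have le: "2 * (t * (\<integral>x. c n x \<partial>M)) - t\<^sup>2 * (\<integral>x. (c n x)\<^sup>2 \<partial>lborel) \<le> S" for n
      by (simp add: power_mult_distrib)
    have "(\<lambda>n. 2 * (t * (\<integral>x. c n x \<partial>M)) - t\<^sup>2 * (\<integral>x. (c n x)\<^sup>2 \<partial>lborel))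
        \<longlonglongrightarrow> 2 * (t * (\<integral>x. indicator K x \<partial>M)) - t\<^sup>2 * (\<integral>x. (indicator K x)\<^sup>2 \<partial>(lborel::real measure))"
      by (intro tendsto_intros l1 l2)
    then have "2 * (t * (\<integral>x. indicator K x \<partial>M)) - t\<^sup>2 * (\<integral>x. (indicator K x)\<^sup>2 \<partial>(lborel::real measure)) \<le> S"
      by (rule LIMSEQ_le_const2) (use le in auto)
    then show ?thesis by (simp add: ind2 K0)
  qed
  have S0: "S \<ge> 0" using *[of 0] by simp
  have "measure M K = 0"
  proof (rule ccontr)
    assume "measure M K \<noteq> 0"
    then have p: "measure M K > 0" by (simp add: zero_less_measure_iff)
    \<comment> \<open>For this t the bound reads \<open>2 * (S + 1) \<le> S\<close>, impossible
      since \<open>0 \<le> S\<close>.\<close>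
    with *[of "(S + 1) / measure M K"] S0 show False by simp
  qed
  then show ?thesis by (simp add: emeasure_eq_measure)
qed simp

text \<open>Distance cutoffs only reach closed sets; inner regularity of the finite Borel measure M
  extends the conclusion from compact null sets to all null sets.\<close>

lemma L2_bound_absolutely_continuous:
  fixes M :: "real measure"
  assumes M: "finite_measure M" "sets M = sets borel"
    and bd: "\<And>g. bump_function g \<Longrightarrow> 2 * (\<integral>x. g x \<partial>M) - (\<integral>x. (g x)\<^sup>2 \<partial>lborel) \<le> S"
  shows "absolutely_continuous lborel M"
  unfolding absolutely_continuous_def
proof
  interpret finite_measure M by fact
  fix A :: "real set" assume A: "A \<in> null_sets lborel"
  then have Ab: "A \<in> sets borel" and A0: "emeasure lborel A = 0" by auto
  have "emeasure M A = (SUP K \<in> {K. K \<subseteq> A \<and> compact K}. emeasure M K)"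
    using M(2) _ Ab by (rule inner_regular) simp
  also have "\<dots> \<le> 0"
  proof (rule SUP_least)
    fix K assume "K \<in> {K. K \<subseteq> A \<and> compact K}"
    then have "K \<subseteq> A" "compact K" by auto
    moreover have "emeasure lborel K = 0"
      using emeasure_mono[OF \<open>K \<subseteq> A\<close>, of lborel] Ab A0 by simp
    ultimately show "emeasure M K \<le> 0" by (simp add: L2_bound_null_compact[OF M bd])
  qed
  finally show "A \<in> null_sets M" using Ab M(2) by (simp add: null_sets_def)
qed

text \<open>A measurable h is a limit of continuous functions off a Lebesgue null set. Clipped to
  [0, B] and cut off, they become bump functions dominated by integrable functions. Absolute
  continuity makes the exceptional set null for M as well, so both integrals converge.\<close>

lemma L2_bound_bounded_function:
  fixes M :: "real measure"
  assumes M: "finite_measure M" "sets M = sets borel"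
    and bd: "\<And>g. bump_function g \<Longrightarrow> 2 * (\<integral>x. g x \<partial>M) - (\<integral>x. (g x)\<^sup>2 \<partial>lborel) \<le> S"
    and ac: "absolutely_continuous lborel M"
    and h[measurable]: "h \<in> borel_measurable borel" and h0: "\<And>x. 0 \<le> h x" "\<And>x. h x \<le> B"
    and hs: "\<And>x. R < \<bar>x\<bar> \<Longrightarrow> h x = 0"
  shows "2 * (\<integral>x. h x \<partial>M) - (\<integral>x. (h x)\<^sup>2 \<partial>lborel) \<le> S"
proof -
  interpret finite_measure M by fact
  have [measurable_cong]: "sets M = sets borel" by fact
  have B0: "0 \<le> B" using h0[of 0] by simp
  have "h \<in> borel_measurable lebesgue" using h by (simp add: measurable_completion)
  then have "h measurable_on UNIV"
    by (rule lebesgue_measurable_imp_measurable_on_nnreal_UNIV) (rule h0)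
  then obtain N f where N: "negligible N" and f: "\<And>n::nat. continuous_on UNIV (f n)"
    and flim: "\<And>x. x \<notin> N \<Longrightarrow> (\<lambda>n. f n x) \<longlonglongrightarrow> h x"
    unfolding measurable_on_def by auto
  \<comment> \<open>Equal to 1 wherever h may be nonzero, so multiplying by it forces compact
    support without changing the limit.\<close>
  define cut where "cut x = max 0 (min 1 (R + 1 - \<bar>x\<bar>))" for x :: real
  define g where "g n x = max 0 (min B (f n x)) * cut x" for n x
  have cut: "0 \<le> cut x" "cut x \<le> 1" "R + 1 < \<bar>x\<bar> \<Longrightarrow> cut x = 0" "\<bar>x\<bar> \<le> R \<Longrightarrow> cut x = 1" for x
    by (auto simp: cut_def)
  have g0: "0 \<le> g n x" "g n x \<le> B" for n x
    using cut[of x] B0 mult_mono[of "max 0 (min B (f n x))" B "cut x" 1] by (auto simp: g_def)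
  have gsupp: "g n x = 0" if "R + 1 < \<bar>x\<bar>" for n x using cut(3)[OF that] by (simp add: g_def)
  have gcont: "continuous_on UNIV (g n)" for n
    unfolding g_def cut_def by (intro continuous_intros f)
  have [measurable]: "g n \<in> borel_measurable borel" for n
    using gcont by (rule borel_measurable_continuous_onI)
  have glim: "(\<lambda>n. g n x) \<longlonglongrightarrow> h x" if "x \<notin> N" for x
  proof -
    have "(\<lambda>n. g n x) \<longlonglongrightarrow> max 0 (min B (h x)) * cut x"
      unfolding g_def by (intro tendsto_intros tendsto_max tendsto_min flim that)
    also have "max 0 (min B (h x)) * cut x = h x"
      using h0[of x] hs[of x] cut(4)[of x] by (cases "R < \<bar>x\<bar>") auto
    finally show ?thesis .
  qed
  have AEl: "AE x in lborel. (\<lambda>n. g n x) \<longlonglongrightarrow> h x"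
  proof -
    \<comment> \<open>N need not be Borel, hence the detour through the completed measure.\<close>
    have "AE x in lebesgue. x \<notin> N"
      using N by (intro AE_not_in) (simp add: negligible_iff_null_sets)
    then have "AE x in lborel. x \<notin> N" by (simp add: AE_completion_iff)
    then show ?thesis by eventually_elim (rule glim)
  qed
  have AEM: "AE x in M. (\<lambda>n. g n x) \<longlonglongrightarrow> h x"
    using absolutely_continuous_AE[OF _ ac AEl] M by simp
  have l1: "(\<lambda>n. \<integral>x. g n x \<partial>M) \<longlonglongrightarrow> (\<integral>x. h x \<partial>M)"
    by (rule integral_dominated_convergence[where w = "\<lambda>_. B"]) (use g0 AEM in auto)
  have l2: "(\<lambda>n. \<integral>x. (g n x)\<^sup>2 \<partial>lborel) \<longlonglongrightarrow> (\<integral>x. (h x)\<^sup>2 \<partial>lborel)"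
  proof (rule integral_dominated_convergence[where w = "\<lambda>x. B\<^sup>2 * indicator {-(R+1)..R+1} x"])
    show "AE x in lborel. norm ((g n x)\<^sup>2) \<le> B\<^sup>2 * indicator {-(R+1)..R+1} x" for n
    proof (intro AE_I2)
      fix x show "norm ((g n x)\<^sup>2) \<le> B\<^sup>2 * indicator {-(R+1)..R+1} x"
        using gsupp[of x n] g0[of n x] by (auto simp: indicator_def abs_le_iff intro!: power_mono)
    qed
    show "AE x in lborel. (\<lambda>n. (g n x)\<^sup>2) \<longlonglongrightarrow> (h x)\<^sup>2"
      using AEl by eventually_elim (intro tendsto_intros)
    show "integrable lborel (\<lambda>x. B\<^sup>2 * indicator {-(R+1)..R+1} x)"
      by (intro integrable_mult_right integrable_real_indicator) (auto simp: emeasure_lborel_Icc_eq)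
  qed auto
  have "bump_function (g n)" for n
    unfolding bump_function_def using g0 gsupp gcont by blast
  then show ?thesis
    by (intro LIMSEQ_le_const2[OF tendsto_diff[OF tendsto_mult[OF tendsto_const l1] l2]]) (use bd in auto)
qed

text \<open>The maximiser g = r may be unbounded, so the test functions are its truncations h. Since
  h \<le> r, the integral of h against M is at least that of h^2, and the hypothesis bounds the
  latter by S. Fatou's lemma removes the truncation.\<close>

lemma L2_bound_imp_density:
  fixes M :: "real measure"
  assumes M: "finite_measure M" "sets M = sets borel"
    and bd: "\<And>g. bump_function g \<Longrightarrow> 2 * (\<integral>x. g x \<partial>M) - (\<integral>x. (g x)\<^sup>2 \<partial>lborel) \<le> S"
  shows "\<exists>r \<in> borel_measurable borel. (\<forall>x. 0 \<le> r x) \<and> M = density lborel (\<lambda>x. ennreal (r x))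
    \<and> (\<integral>\<^sup>+x. (ennreal (r x))\<^sup>2 \<partial>lborel) \<le> ennreal S"
proof -
  interpret finite_measure M by fact
  have [measurable_cong]: "sets M = sets borel" by fact
  have ac: "absolutely_continuous lborel M" by (rule L2_bound_absolutely_continuous[OF M bd])
  define \<rho> where "\<rho> = RN_deriv lborel M"
  have [measurable]: "\<rho> \<in> borel_measurable borel" unfolding \<rho>_def by simp
  have dens: "density lborel \<rho> = M"
    unfolding \<rho>_def by (rule sigma_finite_measure.density_RN_deriv[OF sigma_finite_lborel ac]) (simp add: M)
  have fin: "AE x in lborel. \<rho> x \<noteq> \<infinity>"
    unfolding \<rho>_def
    by (rule sigma_finite_measure.RN_deriv_finite[OF sigma_finite_lborel sigma_finite_measure_axioms ac]) (simp add: M)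
  \<comment> \<open>A finite measure has an almost everywhere finite density, so passing to real
    values changes it only on a null set.\<close>
  define r where "r x = enn2real (\<rho> x)" for x
  have r0: "0 \<le> r x" for x by (simp add: r_def)
  have [measurable]: "r \<in> borel_measurable borel" unfolding r_def by simp
  have "density lborel (\<lambda>x. ennreal (r x)) = density lborel \<rho>"
    by (rule density_cong) (use fin in \<open>auto simp: r_def ennreal_enn2real_if\<close>)
  with dens have Mr: "M = density lborel (\<lambda>x. ennreal (r x))" by simp
  have rint: "integrable lborel r"
  proof -
    have "integrable M (\<lambda>_. 1::real)" by simp
    then show ?thesis using r0 by (subst (asm) Mr, subst (asm) integrable_density) auto
  qed
  define h where "h n x = min (r x) (real n) * indicator {- real n..real n} x" for n x
  have h0: "0 \<le> h n x" "h n x \<le> real n" "h n x \<le> r x" for n x using r0[of x] by (auto simp: h_def indicator_def)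
  have [measurable]: "h n \<in> borel_measurable borel" for n unfolding h_def by simp
  have hb: "(\<integral>\<^sup>+x. ennreal ((h n x)\<^sup>2) \<partial>lborel) \<le> ennreal S" for n
  proof -
    have rh: "integrable lborel (\<lambda>x. r x * h n x)"
    proof (rule Bochner_Integration.integrable_bound)
      show "integrable lborel (\<lambda>x. real n * r x)" using rint by simp
      show "AE x in lborel. norm (r x * h n x) \<le> norm (real n * r x)"
      proof (intro AE_I2)
        fix x
        have "r x * h n x \<le> r x * real n" using h0[of n x] r0[of x] by (intro mult_left_mono) auto
        then show "norm (r x * h n x) \<le> norm (real n * r x)"
          using h0[of n x] r0[of x] by (simp add: mult.commute)
      qed
    qed simp
    have hr: "(h n x)\<^sup>2 \<le> r x * h n x" for x
      unfolding power2_eq_square using h0[where n = n and x = x] by (intro mult_right_mono) auto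
    have hh: "integrable lborel (\<lambda>x. (h n x)\<^sup>2)"
    proof (rule Bochner_Integration.integrable_bound[OF rh])
      show "AE x in lborel. norm ((h n x)\<^sup>2) \<le> norm (r x * h n x)"
        by (intro AE_I2) (use hr in \<open>simp add: order_trans[OF _ abs_ge_self]\<close>)
    qed simp
    have "(\<integral>x. (h n x)\<^sup>2 \<partial>lborel) \<le> (\<integral>x. r x * h n x \<partial>lborel)"
      by (rule integral_mono[OF hh rh]) (rule hr)
    also have "\<dots> = (\<integral>x. h n x \<partial>M)"
      using r0 by (subst Mr, subst integral_density) auto
    finally have "(\<integral>x. (h n x)\<^sup>2 \<partial>lborel) \<le> (\<integral>x. h n x \<partial>M)" .
    moreover have "2 * (\<integral>x. h n x \<partial>M) - (\<integral>x. (h n x)\<^sup>2 \<partial>lborel) \<le> S"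
      by (rule L2_bound_bounded_function[OF M bd ac _ h0(1,2), where R = "real n"]) (auto simp: h_def indicator_def)
    ultimately have "(\<integral>x. (h n x)\<^sup>2 \<partial>lborel) \<le> S" by simp
    then show ?thesis using hh by (simp add: nn_integral_eq_integral ennreal_leI)
  qed
  have lim: "(\<lambda>n. ennreal ((h n x)\<^sup>2)) \<longlonglongrightarrow> (ennreal (r x))\<^sup>2" for x
  proof (rule tendsto_eventually)
    obtain N where N: "max (r x) \<bar>x\<bar> < real N" using reals_Archimedean2 by blast
    have "ennreal ((h n x)\<^sup>2) = (ennreal (r x))\<^sup>2" if "n \<ge> N" for n
      using N that r0[of x] by (auto simp: h_def indicator_def ennreal_power)
    then show "\<forall>\<^sub>F n in sequentially. ennreal ((h n x)\<^sup>2) = (ennreal (r x))\<^sup>2"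
      by (auto simp: eventually_sequentially)
  qed
  have "(\<integral>\<^sup>+x. (ennreal (r x))\<^sup>2 \<partial>lborel) = (\<integral>\<^sup>+x. liminf (\<lambda>n. ennreal ((h n x)\<^sup>2)) \<partial>lborel)"
    by (intro nn_integral_cong lim_imp_Liminf[symmetric] lim) simp
  also have "\<dots> \<le> liminf (\<lambda>n. \<integral>\<^sup>+x. ennreal ((h n x)\<^sup>2) \<partial>lborel)"
    by (rule nn_integral_liminf) simp
  also have "\<dots> \<le> liminf (\<lambda>n::nat. ennreal S)"
    by (rule Liminf_mono) (use hb in auto)
  also have "\<dots> = ennreal S" by (rule Liminf_const) simp
  finally show ?thesis using Mr r0 by (intro bexI[of _ r]) auto
qed

section \<open>Potentials at the origin and measures on the half-line\<close>

text \<open>\<open>Lim\<close> says nothing until a limit is known to exist. For a decreasing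
  function it is the supremum over the positive axis, finite or not.\<close>

lemma pot_ext_0_tendsto:
  assumes "antimono_on {0<..} V"
  shows "((\<lambda>t. ennreal (V t)) \<longlongrightarrow> pot_ext V 0) (at_right 0)"
proof -
  let ?S = "SUP t\<in>{0<..}. ennreal (V t)"
  have "((\<lambda>t. ennreal (V t)) \<longlongrightarrow> ?S) (at_right 0)"
  proof (rule order_tendstoI)
    fix a assume "a < ?S"
    then obtain s where s: "s > 0" "a < ennreal (V s)" by (auto simp: less_SUP_iff)
    have "eventually (\<lambda>t. t \<in> {0<..<s}) (at_right 0)" using s(1) by (intro eventually_at_rightI) auto
    then show "eventually (\<lambda>t. a < ennreal (V t)) (at_right 0)"
    proof eventually_elim
      case (elim t)
      then have "V s \<le> V t" by (intro monotone_onD[OF assms]) auto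
      then show ?case using s(2) by (meson ennreal_leI order_less_le_trans)
    qed
  next
    fix a assume a: "?S < a"
    have "eventually (\<lambda>t::real. t \<in> {0<..}) (at_right 0)" by (rule eventually_at_right_less[THEN eventually_mono]) auto
    then show "eventually (\<lambda>t. ennreal (V t) < a) (at_right 0)"
    proof eventually_elim
      case (elim t)
      then have "ennreal (V t) \<le> ?S" by (intro SUP_upper)
      then show ?case using a by simp
    qed
  qed
  then show ?thesis unfolding pot_ext_def by (simp add: tendsto_Lim)
qed

lemma AE_lborel_ex_interval:
  fixes a b :: real
  assumes "AE x in lborel. P x" "a < b"
  shows "\<exists>x\<in>{a<..<b}. P x"
proof (rule ccontr)
  assume "\<not> ?thesis"
  then have "AE x in lborel. x \<notin> {a<..<b}" using assms(1) by (auto elim!: eventually_mono)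
  then have "{a<..<b} \<in> null_sets lborel" by (subst AE_iff_null_sets) auto
  then show False using assms(2) by (auto simp: null_sets_def)
qed

text \<open>The measures may charge Lebesgue null sets, so the comparison is needed at every point.
  If W exceeded V at z, it would exceed V z on a neighbourhood; on the side of z away from the
  origin V is at most V z, so the inequality would fail on a whole interval. At 0 both sides are
  limits from the right.\<close>

lemma le_pot_ext:
  fixes V W :: "real \<Rightarrow> real"
  assumes even: "\<And>x. V (- x) = V x" and mono: "antimono_on {0<..} V"
    and cont: "continuous_on UNIV W" and le: "AE x in lborel. W x \<le> V x"
  shows "ennreal (W x) \<le> pot_ext V x"
proof -
  have isC: "isCont W z" for z using cont by (simp add: continuous_on_eq_continuous_at)
  have near: "\<exists>d>0. \<forall>y. \<bar>y - z\<bar> < d \<longrightarrow> c < W y" if "c < W z" for c z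
  proof -
    have "\<forall>\<^sub>F y in nhds z. c < W y"
      using order_tendstoD(1)[OF isC[of z, unfolded isCont_def tendsto_at_iff_tendsto_nhds] that] .
    then show ?thesis by (auto simp: eventually_nhds_metric dist_real_def)
  qed
  have pos: "W z \<le> V z" if z: "z > 0" for z
  proof (rule ccontr)
    assume "\<not> W z \<le> V z"
    then obtain d where d: "d > 0" "\<And>y. \<bar>y - z\<bar> < d \<Longrightarrow> V z < W y" using near[of "V z" z] by auto
    obtain y where y: "y \<in> {z<..<z + d}" "W y \<le> V y" using AE_lborel_ex_interval[OF le, of z "z + d"] d(1) by auto
    then have "V y \<le> V z" using z by (intro monotone_onD[OF mono]) auto
    with d(2)[of y] y show False by auto
  qed
  have neg: "W z \<le> V z" if z: "z < 0" for z
  proof (rule ccontr)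
    assume "\<not> W z \<le> V z"
    then obtain d where d: "d > 0" "\<And>y. \<bar>y - z\<bar> < d \<Longrightarrow> V z < W y" using near[of "V z" z] by auto
    obtain y where y: "y \<in> {z - d<..<z}" "W y \<le> V y" using AE_lborel_ex_interval[OF le, of "z - d" z] d(1) by auto
    then have "V (- y) \<le> V (- z)" using z by (intro monotone_onD[OF mono]) auto
    with d(2)[of y] y show False by (auto simp: even)
  qed
  show ?thesis
  proof (cases "x = 0")
    case True
    have "((\<lambda>t. ennreal (W t)) \<longlongrightarrow> ennreal (W 0)) (at_right 0)"
      using isC[of 0] by (intro tendsto_ennrealI) (simp add: isCont_def filterlim_at_split)
    moreover have "\<forall>\<^sub>F t in at_right 0. ennreal (W t) \<le> ennreal (V t)"
      by (rule eventually_at_right_less[THEN eventually_mono]) (auto intro!: ennreal_leI pos)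
    ultimately show ?thesis unfolding True
      by (intro tendsto_le[OF _ pot_ext_0_tendsto[OF mono]]) auto
  next
    case False
    then have "W x \<le> V x" using pos[of x] neg[of x] by linarith
    then show ?thesis using False by (auto simp: pot_ext_def intro!: ennreal_leI)
  qed
qed

text \<open>Elements of \<open>prob_halfline\<close> live on the trace sigma-algebra of [0,
  \<infinity>). Their images on the line are Borel measures there, as the transforms, inner
  regularity and weak convergence require.\<close>

definition on_line :: "real measure \<Rightarrow> real measure" where
  "on_line \<mu> = distr \<mu> borel (\<lambda>x. x)"

lemma halfline_measurable_id:
  assumes "\<mu> \<in> prob_halfline"
  shows "(\<lambda>x. x) \<in> measurable \<mu> borel"
proof -
  have "sets \<mu> = sets (restrict_space borel {0..})" using assms by (simp add: prob_halfline_def)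
  then show ?thesis
    by (subst measurable_cong_sets[OF _ refl]) (auto intro: measurable_restrict_space1)
qed

lemma space_halfline:
  assumes "\<mu> \<in> prob_halfline"
  shows "space \<mu> = {0..}"
proof -
  have "sets \<mu> = sets (restrict_space borel {0..})" using assms by (simp add: prob_halfline_def)
  from sets_eq_imp_space_eq[OF this] show ?thesis by (simp add: space_restrict_space)
qed

lemma sets_on_line: "sets (on_line \<mu>) = sets borel" by (simp add: on_line_def)

lemma prob_space_on_line: "\<mu> \<in> prob_halfline \<Longrightarrow> prob_space (on_line \<mu>)"
  unfolding on_line_def
  by (intro prob_space.prob_space_distr halfline_measurable_id) (simp_all add: prob_halfline_def)

lemma integral_on_line:
  fixes f :: "real \<Rightarrow> real"
  shows "\<mu> \<in> prob_halfline \<Longrightarrow> f \<in> borel_measurable borel \<Longrightarrow> (\<integral>x. f x \<partial>on_line \<mu>) = (\<integral>x. f x \<partial>\<mu>)"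
  unfolding on_line_def by (rule integral_distr[OF halfline_measurable_id])

lemma nn_integral_on_line:
  "\<mu> \<in> prob_halfline \<Longrightarrow> f \<in> borel_measurable borel \<Longrightarrow> (\<integral>\<^sup>+x. f x \<partial>on_line \<mu>) = (\<integral>\<^sup>+x. f x \<partial>\<mu>)"
  unfolding on_line_def by (rule nn_integral_distr[OF halfline_measurable_id]) simp_all

lemma real_distribution_on_line: "\<mu> \<in> prob_halfline \<Longrightarrow> real_distribution (on_line \<mu>)"
  using prob_space_on_line
  by (simp add: real_distribution_def real_distribution_axioms_def on_line_def)

section \<open>Tightness and narrow compactness on the half-line\<close>

lemma tight_on_line:
  assumes m: "\<And>n. m n \<in> prob_halfline" and C: "\<And>n. (\<integral>\<^sup>+x. ennreal x \<partial>m n) \<le> ennreal C"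
  shows "tight (\<lambda>n. on_line (m n))"
  unfolding tight_def
proof (intro conjI allI impI)
  show "real_distribution (on_line (m n))" for n by (rule real_distribution_on_line[OF m])
  fix e :: real assume e: "e > 0"
  \<comment> \<open>Markov's inequality gives a tail of at most \<bar>C\<bar> / K; the added 1 makes
    this strictly less than e and keeps K positive when C = 0.\<close>
  define K where "K = (\<bar>C\<bar> + 1) / e"
  have K: "K > 0" "\<bar>C\<bar> / K < e" using e by (auto simp: K_def field_simps)
  \<comment> \<open>The interval is open on the left and there may be an atom at 0, so the left end
    must be negative.\<close>
  have "1 - e < measure (on_line (m n)) {-1<..K}" for n
  proof -
    let ?N = "on_line (m n)"
    interpret N: real_distribution ?N by (rule real_distribution_on_line[OF m])
    have "ennreal K * emeasure ?N {K<..} = (\<integral>\<^sup>+x. ennreal K * indicator {K<..} x \<partial>?N)"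
      by (simp add: nn_integral_cmult_indicator)
    also have "\<dots> \<le> (\<integral>\<^sup>+x. ennreal x \<partial>?N)"
      by (intro nn_integral_mono) (auto simp: indicator_def intro!: ennreal_leI)
    also have "\<dots> \<le> ennreal C" using C by (simp add: nn_integral_on_line m)
    also have "\<dots> \<le> ennreal \<bar>C\<bar>" by (intro ennreal_leI) simp
    finally have "K * measure ?N {K<..} \<le> \<bar>C\<bar>"
      using K by (simp add: N.emeasure_eq_measure ennreal_mult[symmetric])
    then have "measure ?N {K<..} \<le> \<bar>C\<bar> / K" using K by (simp add: field_simps)
    then have big: "measure ?N {K<..} < e" using K by simp
    have "emeasure ?N {..-1} = emeasure (m n) ((\<lambda>x. x) -` {..-1} \<inter> space (m n))"
      unfolding on_line_def by (rule emeasure_distr[OF halfline_measurable_id[OF m]]) simp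
    also have "(\<lambda>x. x) -` {..-1} \<inter> space (m n) = {}" by (auto simp: space_halfline[OF m])
    finally have small: "measure ?N {..-1} = 0" by (simp add: measure_def)
    have "1 = measure ?N UNIV" using N.prob_space by simp
    also have "\<dots> = measure ?N ({..-1} \<union> {-1<..K} \<union> {K<..})"
      using K by (intro arg_cong[where f = "measure ?N"]) auto
    also have "\<dots> \<le> measure ?N ({..-1} \<union> {-1<..K}) + measure ?N {K<..}"
      by (rule measure_Un_le) auto
    also have "\<dots> \<le> measure ?N {..-1} + measure ?N {-1<..K} + measure ?N {K<..}"
      by (intro add_right_mono measure_Un_le) auto
    finally show ?thesis using big small by simp
  qed
  moreover have "-1 < K" using K by simp
  ultimately show "\<exists>a b. a < b \<and> (\<forall>n. 1 - e < measure (on_line (m n)) {a<..b})" by blast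
qed

text \<open>The closed half-line keeps all mass in the limit, so restricting the limit on the line
  again gives a probability measure.\<close>

lemma weak_conv_on_line_imp_narrow:
  fixes m :: "nat \<Rightarrow> real measure"
  assumes m: "\<And>n. m n \<in> prob_halfline" and M: "real_distribution M"
    and conv: "weak_conv_m (\<lambda>n. on_line (m n)) M"
  shows "restrict_space M {0..} \<in> prob_halfline" "narrow_conv m (restrict_space M {0..}) sequentially"
proof -
  interpret M: real_distribution M by fact
  have test: "(\<lambda>n. \<integral>x. f x \<partial>on_line (m n)) \<longlonglongrightarrow> (\<integral>x. f x \<partial>M)"
    if "\<And>x. isCont f x" "\<And>x. norm (f x) \<le> B" for f :: "real \<Rightarrow> real" and B
    by (rule weak_conv_imp_integral_bdd_continuous_conv[OF real_distribution_on_line[OF m] M conv that])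
  \<comment> \<open>A bounded continuous function that is positive exactly on the negative axis; its
    integral against the limit vanishes.\<close>
  define p where "p x = min 1 (max 0 (- x))" for x :: real
  have p: "0 \<le> p x" "p x \<le> 1" for x by (auto simp: p_def)
  have pc: "continuous_on UNIV p" unfolding p_def by (intro continuous_intros)
  then have [measurable]: "p \<in> borel_measurable borel" by (rule borel_measurable_continuous_onI)
  have "(\<integral>x. p x \<partial>on_line (m n)) = 0" for n
  proof -
    have "(\<integral>x. p x \<partial>m n) = (\<integral>x. 0 \<partial>m n)"
      by (rule Bochner_Integration.integral_cong) (auto simp: space_halfline[OF m] p_def)
    then show ?thesis by (simp add: integral_on_line m)
  qed
  moreover have "(\<lambda>n. \<integral>x. p x \<partial>on_line (m n)) \<longlonglongrightarrow> (\<integral>x. p x \<partial>M)"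
    by (rule test[of _ 1]) (use pc p in \<open>auto simp: continuous_on_eq_continuous_at\<close>)
  ultimately have "(\<integral>x. p x \<partial>M) = 0" by (simp add: LIMSEQ_const_iff)
  moreover have "integrable M p"
    by (rule integrable_bounded_finite[of _ _ 1]) (use p M.finite_measure_axioms in auto)
  ultimately have "AE x in M. p x = 0" using p by (subst (asm) integral_nonneg_eq_0_iff_AE) auto
  then have nn: "AE x in M. x \<in> {0..}"
    by eventually_elim (auto simp: p_def min_def max_def split: if_splits)
  have e1: "emeasure M {0..} = 1" using nn by (intro M.emeasure_eq_1_AE) auto
  show "restrict_space M {0..} \<in> prob_halfline"
    unfolding prob_halfline_def
    by (auto intro!: prob_space_restrict_space e1 sets_restrict_space_cong)
  show "narrow_conv m (restrict_space M {0..}) sequentially"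
    unfolding narrow_conv_def
  proof (intro allI impI)
    fix f :: "real \<Rightarrow> real" assume f: "continuous_on {0..} f" "bounded (f ` {0..})"
    \<comment> \<open>Extends f by the constant f 0 to the left, preserving continuity and
      boundedness.\<close>
    define F where "F x = f (max 0 x)" for x
    have Fc: "continuous_on UNIV F"
      unfolding F_def by (intro continuous_on_compose2[OF f(1)] continuous_intros) auto
    then have [measurable]: "F \<in> borel_measurable borel" by (rule borel_measurable_continuous_onI)
    obtain B where B: "\<And>x. x \<ge> 0 \<Longrightarrow> norm (f x) \<le> B" using f(2) by (auto simp: bounded_iff)
    have "(\<lambda>n. \<integral>x. F x \<partial>on_line (m n)) \<longlonglongrightarrow> (\<integral>x. F x \<partial>M)"
      by (rule test[of _ B]) (use Fc B in \<open>auto simp: continuous_on_eq_continuous_at F_def\<close>)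
    moreover have "(\<integral>x. F x \<partial>on_line (m n)) = (\<integral>x. f x \<partial>m n)" for n
      unfolding integral_on_line[OF m \<open>F \<in> borel_measurable borel\<close>]
      by (rule Bochner_Integration.integral_cong) (auto simp: space_halfline[OF m] F_def)
    moreover have "(\<integral>x. f x \<partial>restrict_space M {0..}) = (\<integral>x. F x \<partial>M)"
    proof -
      have "(\<integral>x. f x \<partial>restrict_space M {0..}) = (\<integral>x. F x \<partial>restrict_space M {0..})"
        by (rule Bochner_Integration.integral_cong) (auto simp: space_restrict_space F_def)
      also have "\<dots> = (\<integral>x. indicator {0..} x *\<^sub>R F x \<partial>M)" by (rule integral_restrict_space) simp
      also have "\<dots> = (\<integral>x. F x \<partial>M)"
        by (rule integral_cong_AE) (use nn in \<open>auto elim!: eventually_mono\<close>)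
      finally show ?thesis .
    qed
    ultimately show "(\<lambda>n. \<integral>x. f x \<partial>m n) \<longlonglongrightarrow> (\<integral>x. f x \<partial>restrict_space M {0..})" by simp
  qed
qed

lemma narrow_compactness:
  fixes m :: "nat \<Rightarrow> real measure"
  assumes m: "\<And>n. m n \<in> prob_halfline" and C: "\<And>n. (\<integral>\<^sup>+x. ennreal x \<partial>m n) \<le> ennreal C"
  shows "\<exists>\<mu>\<in>prob_halfline. \<exists>r :: nat \<Rightarrow> nat. strict_mono r \<and> narrow_conv (\<lambda>n. m (r n)) \<mu> sequentially"
proof -
  have tight: "tight (\<lambda>n. on_line (m n))" by (rule tight_on_line) (fact m C)+
  obtain r M where r: "strict_mono (r :: nat \<Rightarrow> nat)" and M: "real_distribution M"
    and w: "weak_conv_m ((\<lambda>n. on_line (m n)) \<circ> id \<circ> r) M"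
    using tight_imp_convergent_subsubsequence[OF tight strict_mono_id] by blast
  have w': "weak_conv_m (\<lambda>n. on_line (m (r n))) M" using w by (simp add: o_def)
  show ?thesis
    using weak_conv_on_line_imp_narrow[of "\<lambda>n. m (r n)", OF m M w'] r by blast
qed

section \<open>Energy bounds\<close>

lemma bump_functionE:
  assumes "bump_function g"
  obtains B where "uniformly_continuous_on UNIV g" "continuous_on UNIV g" "\<And>x. 0 \<le> g x" "\<And>x. g x \<le> B"
    "integrable lborel g" "finite_measure (density lborel g)"
proof -
  obtain R where cont: "continuous_on UNIV g" and g0: "\<And>x. 0 \<le> g x" and R: "\<And>x. R < \<bar>x\<bar> \<Longrightarrow> g x = 0"
    using assms unfolding bump_function_def by blast
  have "bounded (g ` {-R..R})"
    by (intro compact_imp_bounded compact_continuous_image continuous_on_subset[OF cont]) auto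
  then obtain C where C: "\<And>x. x \<in> {-R..R} \<Longrightarrow> norm (g x) \<le> C" unfolding bounded_iff by blast
  have gB: "g x \<le> max C 0" for x
  proof (cases "x \<in> {-R..R}")
    case True
    then show ?thesis using C[of x] by auto
  next
    case False
    then show ?thesis using R[of x] by auto
  qed
  have [measurable]: "g \<in> borel_measurable borel" using cont by (rule borel_measurable_continuous_onI)
  have int: "integrable lborel g"
  proof (rule Bochner_Integration.integrable_bound)
    show "integrable lborel (\<lambda>x. max C 0 * indicator {-R..R} x)"
      by (intro integrable_mult_right integrable_real_indicator) (auto simp: emeasure_lborel_Icc_eq)
    show "AE x in lborel. norm (g x) \<le> norm (max C 0 * indicator {-R..R} x)"
    proof (intro AE_I2)
      fix x show "norm (g x) \<le> norm (max C 0 * indicator {-R..R} x)"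
        using R[of x] gB[of x] g0[of x] by (cases "x \<in> {-R..R}") auto
    qed
  qed simp
  have "emeasure (density lborel g) (space (density lborel g)) = (\<integral>\<^sup>+x. g x \<partial>lborel)"
    by (simp add: emeasure_density)
  also have "\<dots> = ennreal (\<integral>x. g x \<partial>lborel)" using int g0 by (intro nn_integral_eq_integral) auto
  finally have "finite_measure (density lborel g)" by (intro finite_measureI) simp
  then show ?thesis
    using that uniformly_continuous_compact_support[OF cont R] cont g0 gB int by blast
qed

text \<open>The self-interaction of \<open>m \<gamma>\<close> need not converge, so the result is
  stated as a convergent minorant A, made of the terms containing g after the dilated measures are
  inserted into \<open>interaction_pos_def\<close>.\<close>

lemma interaction_energy_lower_bound:
  fixes W g :: "real \<Rightarrow> real" and m :: "real \<Rightarrow> real measure"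
  assumes cont: "continuous_on UNIV W" and B: "\<And>z. \<bar>W z\<bar> \<le> B" and W: "integrable lborel W"
    and pos: "\<And>w. fourier W w \<in> \<real> \<and> 0 \<le> Re (fourier W w)"
    and g: "bump_function g"
    and pm: "\<And>\<gamma>. prob_space (m \<gamma>)" and sm: "\<And>\<gamma>. sets (m \<gamma>) = sets borel"
    and lim: "((\<lambda>\<gamma>. \<integral>x. g x \<partial>m \<gamma>) \<longlongrightarrow> l) at_top"
  shows "\<exists>A. (A \<longlongrightarrow> (\<integral>x. W x \<partial>lborel) * (2 * l - (\<integral>x. (g x)\<^sup>2 \<partial>lborel))) at_top \<and>
     (\<forall>\<gamma>>0. A \<gamma> \<le> \<gamma> * interaction (\<lambda>z. W (\<gamma> * z)) (m \<gamma>) (m \<gamma>))"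
proof -
  obtain C where uc: "uniformly_continuous_on UNIV g" and gc: "continuous_on UNIV g"
    and g0: "\<And>x. 0 \<le> g x" and gC: "\<And>x. g x \<le> C"
    and gint: "integrable lborel g" and fin: "finite_measure (density lborel g)"
    using bump_functionE[OF g] by metis
  have [measurable]: "g \<in> borel_measurable borel" using gint by simp
  have Wm[measurable]: "W \<in> borel_measurable borel" using W by simp
  define N where "N = density lborel (\<lambda>x. ennreal (g x))"
  have Ns: "sets N = sets borel" and fN: "finite_measure N" using fin by (simp_all add: N_def)
  have fm: "finite_measure (m \<gamma>)" for \<gamma> using pm by (simp add: prob_space_def)
  have m1: "measure (m \<gamma>) (space (m \<gamma>)) \<le> 1" for \<gamma> using prob_space.prob_space[OF pm] by simp
  have W': "integrable lborel (\<lambda>x. W (- x))"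
    using lborel_integrable_real_affine[OF W, of "-1" 0] by simp
  have W'eq: "(\<integral>x. W (- x) \<partial>lborel) = (\<integral>x. W x \<partial>lborel)"
    by (subst (2) lborel_integral_real_affine[where c = "-1" and t = 0]) auto
  have gg: "(\<integral>x. g x \<partial>N) = (\<integral>x. (g x)\<^sup>2 \<partial>lborel)"
    unfolding N_def using g0 by (subst integral_density) (auto simp: power2_eq_square)
  have t1: "((\<lambda>\<gamma>. \<gamma> * interaction (\<lambda>z. W (\<gamma> * z)) N (m \<gamma>)) \<longlongrightarrow> (\<integral>x. W x \<partial>lborel) * l) at_top"
    unfolding N_def by (rule scaled_interaction_tendsto[OF W uc g0 gC fm sm m1 lim])
  \<comment> \<open>The other cross term: by \<open>interaction_swap\<close> it has the reflected
    kernel, whose mass is the same.\<close>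
  have t2: "((\<lambda>\<gamma>. \<gamma> * interaction (\<lambda>z. W (- (\<gamma> * z))) N (m \<gamma>)) \<longlongrightarrow> (\<integral>x. W x \<partial>lborel) * l) at_top"
    using scaled_interaction_tendsto[OF W' uc g0 gC fm sm m1 lim] unfolding N_def W'eq .
  \<comment> \<open>The same limit with the constant family N = g dx, where l is the integral of g
    against N, that is, of g^2.\<close>
  have t3: "((\<lambda>\<gamma>. \<gamma> * interaction (\<lambda>z. W (\<gamma> * z)) N N) \<longlongrightarrow> (\<integral>x. W x \<partial>lborel) * (\<integral>x. (g x)\<^sup>2 \<partial>lborel)) at_top"
    using scaled_interaction_tendsto[OF W uc g0 gC fN Ns order_refl tendsto_const]
    unfolding N_def[symmetric] gg .
  define A where "A \<gamma> = \<gamma> * interaction (\<lambda>z. W (\<gamma> * z)) N (m \<gamma>)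
      + \<gamma> * interaction (\<lambda>z. W (- (\<gamma> * z))) N (m \<gamma>) - \<gamma> * interaction (\<lambda>z. W (\<gamma> * z)) N N" for \<gamma>
  have "(A \<longlongrightarrow> (\<integral>x. W x \<partial>lborel) * l + (\<integral>x. W x \<partial>lborel) * l
      - (\<integral>x. W x \<partial>lborel) * (\<integral>x. (g x)\<^sup>2 \<partial>lborel)) at_top"
    unfolding A_def by (intro tendsto_intros t1 t2 t3)
  then have lA: "(A \<longlongrightarrow> (\<integral>x. W x \<partial>lborel) * (2 * l - (\<integral>x. (g x)\<^sup>2 \<partial>lborel))) at_top"
    by (simp add: algebra_simps)
  have "A \<gamma> \<le> \<gamma> * interaction (\<lambda>z. W (\<gamma> * z)) (m \<gamma>) (m \<gamma>)" if \<gamma>: "\<gamma> > 0" for \<gamma>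
  proof -
    let ?D = "\<lambda>M. distr M borel ((*) \<gamma>)"
    have fD: "finite_measure (?D M)" if "finite_measure M" "sets M = sets borel" for M
    proof -
      have [measurable_cong]: "sets M = sets borel" by fact
      show ?thesis using that(1) by (intro finite_measure.finite_measure_distr) measurable
    qed
    have sc: "interaction (\<lambda>z. W (\<gamma> * z)) P Q = interaction W (?D P) (?D Q)"
      if "finite_measure P" "sets P = sets borel" "sets Q = sets borel" for P Q
      by (rule interaction_scale[OF that Wm])
    have "interaction W (?D (m \<gamma>)) (?D N) + interaction W (?D N) (?D (m \<gamma>))
        \<le> interaction W (?D (m \<gamma>)) (?D (m \<gamma>)) + interaction W (?D N) (?D N)"
      by (rule interaction_pos_def[OF _ _ _ _ cont B W pos]) (auto intro: fD[OF fm sm] fD[OF fN Ns])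
    moreover have "interaction (\<lambda>z. W (\<gamma> * z)) (m \<gamma>) N = interaction (\<lambda>z. W (- (\<gamma> * z))) N (m \<gamma>)"
      by (subst interaction_swap[OF fm sm fN Ns, of _ B]) (use B in auto)
    ultimately have "interaction (\<lambda>z. W (- (\<gamma> * z))) N (m \<gamma>) + interaction (\<lambda>z. W (\<gamma> * z)) N (m \<gamma>)
        \<le> interaction (\<lambda>z. W (\<gamma> * z)) (m \<gamma>) (m \<gamma>) + interaction (\<lambda>z. W (\<gamma> * z)) N N"
      using sc fm sm fN Ns by metis
    from mult_left_mono[OF this less_imp_le[OF \<gamma>]] show ?thesis by (simp add: A_def algebra_simps)
  qed
  with lA show ?thesis by blast
qed

text \<open>Only an inequality, because f may change sign and \<open>ennreal\<close> discards its
  negative part pointwise.\<close>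

lemma ennreal_integral_le_nn_integral:
  fixes f :: "'a \<Rightarrow> real"
  assumes "integrable M f"
  shows "ennreal (\<integral>x. f x \<partial>M) \<le> (\<integral>\<^sup>+x. ennreal (f x) \<partial>M)"
proof -
  have i: "integrable M (\<lambda>x. max 0 (f x))" using assms by auto
  have "(\<integral>x. f x \<partial>M) \<le> (\<integral>x. max 0 (f x) \<partial>M)" using assms i by (intro integral_mono) auto
  then have "ennreal (\<integral>x. f x \<partial>M) \<le> ennreal (\<integral>x. max 0 (f x) \<partial>M)" by (rule ennreal_leI)
  also have "\<dots> = (\<integral>\<^sup>+x. ennreal (max 0 (f x)) \<partial>M)"
    using i by (intro nn_integral_eq_integral[symmetric]) auto
  also have "\<dots> = (\<integral>\<^sup>+x. ennreal (f x) \<partial>M)"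
    by (intro nn_integral_cong) (auto simp: max_def ennreal_neg)
  finally show ?thesis .
qed

lemma energy_lower_bound:
  fixes V W :: "real \<Rightarrow> real"
  assumes m: "m \<in> prob_halfline" and \<gamma>: "\<gamma> > 0" and T: "T \<ge> 0"
    and cont: "continuous_on UNIV W" and B: "\<And>z. \<bar>W z\<bar> \<le> B"
    and le: "\<And>z. ennreal (W z) \<le> pot_ext V z"
  shows "ennreal (1 / 2 * (\<gamma> * interaction (\<lambda>z. W (\<gamma> * z)) (on_line m) (on_line m)) + (\<integral>x. min x T \<partial>m))
     \<le> energy V \<gamma> m"
proof -
  let ?N = "on_line m"
  interpret N: prob_space ?N by (rule prob_space_on_line[OF m])
  have [measurable_cong]: "sets ?N = sets borel" by (rule sets_on_line)
  have [measurable]: "W \<in> borel_measurable borel" using cont by (rule borel_measurable_continuous_onI)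
  have fin: "finite_measure ?N" by (rule N.finite_measure_axioms)
  have inner: "integrable ?N (\<lambda>x. W (\<gamma> * (x - y)))" for y
    by (rule integrable_bounded_finite[OF fin, of _ B]) (use B in auto)
  define I where "I y = (\<integral>x. W (\<gamma> * (x - y)) \<partial>?N)" for y
  have [measurable]: "I \<in> borel_measurable borel" unfolding I_def by measurable
  have IB: "\<bar>I y\<bar> \<le> B" for y
  proof -
    have "\<bar>I y\<bar> \<le> (\<integral>x. \<bar>W (\<gamma> * (x - y))\<bar> \<partial>?N)" unfolding I_def by (rule integral_abs_bound)
    also have "\<dots> \<le> (\<integral>x. B \<partial>?N)" using inner B by (intro integral_mono) auto
    finally show ?thesis using N.prob_space by simp
  qed
  have Iint: "integrable ?N I"
    by (rule integrable_bounded_finite[OF fin, of _ B]) (use IB in auto)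
  have "ennreal (interaction (\<lambda>z. W (\<gamma> * z)) ?N ?N) \<le> (\<integral>\<^sup>+y. ennreal (I y) \<partial>?N)"
    unfolding interaction_def I_def[symmetric] by (rule ennreal_integral_le_nn_integral[OF Iint])
  also have "\<dots> = (\<integral>\<^sup>+y. ennreal (I y) \<partial>m)" by (rule nn_integral_on_line[OF m]) simp
  also have "\<dots> \<le> (\<integral>\<^sup>+y. (\<integral>\<^sup>+x. pot_ext V (\<gamma> * (x - y)) \<partial>m) \<partial>m)"
  proof (rule nn_integral_mono)
    fix y
    have "ennreal (I y) \<le> (\<integral>\<^sup>+x. ennreal (W (\<gamma> * (x - y))) \<partial>?N)"
      unfolding I_def by (rule ennreal_integral_le_nn_integral[OF inner])
    also have "\<dots> = (\<integral>\<^sup>+x. ennreal (W (\<gamma> * (x - y))) \<partial>m)" by (rule nn_integral_on_line[OF m]) simp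
    also have "\<dots> \<le> (\<integral>\<^sup>+x. pot_ext V (\<gamma> * (x - y)) \<partial>m)" by (intro nn_integral_mono le)
    finally show "ennreal (I y) \<le> (\<integral>\<^sup>+x. pot_ext V (\<gamma> * (x - y)) \<partial>m)" .
  qed
  finally have a: "ennreal (1 / 2 * \<gamma>) * ennreal (interaction (\<lambda>z. W (\<gamma> * z)) ?N ?N)
     \<le> ennreal (1 / 2 * \<gamma>) * (\<integral>\<^sup>+y. (\<integral>\<^sup>+x. pot_ext V (\<gamma> * (x - y)) \<partial>m) \<partial>m)"
    by (rule mult_left_mono) simp
  have pm: "finite_measure m" "sets m = sets (restrict_space borel {0..})"
    using m by (auto simp: prob_halfline_def prob_space_def)
  have mint: "integrable m (\<lambda>x. min x T)"
  proof (rule finite_measure.integrable_const_bound[OF pm(1), of _ T])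
    show "AE x in m. norm (min x T) \<le> T" using T by (intro AE_I2) (auto simp: space_halfline[OF m])
    show "(\<lambda>x. min x T) \<in> borel_measurable m"
      using halfline_measurable_id[OF m] by simp
  qed
  have "ennreal (\<integral>x. min x T \<partial>m) \<le> (\<integral>\<^sup>+x. ennreal (min x T) \<partial>m)"
    by (rule ennreal_integral_le_nn_integral[OF mint])
  also have "\<dots> \<le> (\<integral>\<^sup>+x. ennreal x \<partial>m)" by (intro nn_integral_mono ennreal_leI) simp
  finally have b: "ennreal (\<integral>x. min x T \<partial>m) \<le> (\<integral>\<^sup>+x. ennreal x \<partial>m)" .
  \<comment> \<open>The interaction with W may be negative, and \<open>ennreal\<close> is additive
    only on nonnegative summands; hence the passage to positive parts.\<close>
  have "ennreal (1 / 2 * (\<gamma> * interaction (\<lambda>z. W (\<gamma> * z)) ?N ?N) + (\<integral>x. min x T \<partial>m))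
     \<le> ennreal (max 0 (1 / 2 * (\<gamma> * interaction (\<lambda>z. W (\<gamma> * z)) ?N ?N)) + max 0 (\<integral>x. min x T \<partial>m))"
    by (intro ennreal_leI add_mono) auto
  also have "\<dots> = ennreal (1 / 2 * \<gamma> * interaction (\<lambda>z. W (\<gamma> * z)) ?N ?N) + ennreal (\<integral>x. min x T \<partial>m)"
    by (subst ennreal_plus) (auto simp: max_def ennreal_neg)
  also have "ennreal (1 / 2 * \<gamma> * interaction (\<lambda>z. W (\<gamma> * z)) ?N ?N)
      = ennreal (1 / 2 * \<gamma>) * ennreal (interaction (\<lambda>z. W (\<gamma> * z)) ?N ?N)"
    by (rule ennreal_mult') (use \<gamma> in simp)
  finally show ?thesis unfolding energy_def using add_mono[OF a b] by (rule order_trans)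
qed

section \<open>Upper bound by the limit energy\<close>

lemma sigma_finite_lborel_halfline: "sigma_finite_measure (restrict_space lborel {0::real..})"
  by (rule sigma_finite_measure_restrict_space[OF sigma_finite_lborel]) simp

text \<open>Uniqueness of densities frees the limit energy from the particular choice
  \<open>RN_deriv\<close>. The linear term becomes the first moment of \<mu>, literally the one in
  \<open>energy\<close>.\<close>

lemma limit_energy_density:
  assumes f: "f \<in> borel_measurable (restrict_space lborel {0..})"
    and \<mu>: "\<mu> = density (restrict_space lborel {0..}) f"
  shows "limit_energy a \<mu> = ennreal a * (\<integral>\<^sup>+x. (f x)\<^sup>2 \<partial>restrict_space lborel {0..}) + (\<integral>\<^sup>+x. ennreal x \<partial>\<mu>)"
proof -
  let ?L = "restrict_space lborel {0::real..}"
  have ae: "AE x in ?L. f x = RN_deriv ?L \<mu> x"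
    by (rule sigma_finite_measure.RN_deriv_unique[OF sigma_finite_lborel_halfline f \<mu>[symmetric]])
  have id: "(\<lambda>x. ennreal x) \<in> borel_measurable ?L" by (rule measurable_restrict_space1) simp
  have "(\<integral>\<^sup>+x. ennreal x \<partial>\<mu>) = (\<integral>\<^sup>+x. f x * ennreal x \<partial>?L)"
    unfolding \<mu> by (rule nn_integral_density[OF f id])
  also have "\<dots> = (\<integral>\<^sup>+x. ennreal x * RN_deriv ?L \<mu> x \<partial>?L)"
    by (rule nn_integral_cong_AE) (use ae in \<open>auto elim!: eventually_mono simp: mult.commute\<close>)
  finally have 1: "(\<integral>\<^sup>+x. ennreal x \<partial>\<mu>) = (\<integral>\<^sup>+x. ennreal x * RN_deriv ?L \<mu> x \<partial>?L)" .
  have 2: "(\<integral>\<^sup>+x. (f x)\<^sup>2 \<partial>?L) = (\<integral>\<^sup>+x. (RN_deriv ?L \<mu> x)\<^sup>2 \<partial>?L)"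
    by (rule nn_integral_cong_AE) (use ae in \<open>auto elim!: eventually_mono\<close>)
  have ex: "\<exists>f\<in>borel_measurable ?L. \<mu> = density ?L f" using f \<mu> by blast
  show ?thesis unfolding limit_energy_def Let_def 1 2 using ex by simp
qed

text \<open>With a density the diagonal is not charged, so a possibly infinite V(0) does not enter.
  \<open>interaction_upper_bound\<close> then applies with a kernel of mass 2a, and the prefactor
  1/2 leaves a. Without a density the right-hand side is infinite.\<close>

lemma energy_le_limit_energy:
  fixes V :: "real \<Rightarrow> real"
  assumes V: "antimono_on {0<..} V" "integrable lborel V" "\<And>x. V (- x) = V x" and \<gamma>: "\<gamma> > 0"
  shows "energy V \<gamma> \<mu> \<le> limit_energy (LBINT x:{0<..}. V x) \<mu>"
proof (cases "\<exists>f\<in>borel_measurable (restrict_space lborel {0..}). \<mu> = density (restrict_space lborel {0..}) f")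
  case False
  then show ?thesis by (simp add: limit_energy_def Let_def)
next
  case True
  let ?L = "restrict_space lborel {0::real..}"
  define a where "a = (LBINT x:{0<..}. V x)"
  obtain f where f: "f \<in> borel_measurable ?L" and \<mu>: "\<mu> = density ?L f" using True by blast
  define \<rho> where "\<rho> x = f x * indicator {0..} x" for x
  have \<rho>[measurable]: "\<rho> \<in> borel_measurable borel"
    using f unfolding \<rho>_def by (subst (asm) borel_measurable_restrict_space_iff_ennreal) auto
  have [measurable]: "V \<in> borel_measurable borel" using V(2) by simp
  have int\<mu>: "(\<integral>\<^sup>+x. h x \<partial>\<mu>) = (\<integral>\<^sup>+x. \<rho> x * h x \<partial>lborel)" if [measurable]: "h \<in> borel_measurable borel" for h
  proof -
    have "(\<integral>\<^sup>+x. h x \<partial>\<mu>) = (\<integral>\<^sup>+x. f x * h x \<partial>?L)"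
      unfolding \<mu> by (rule nn_integral_density[OF f]) (rule measurable_restrict_space1, simp)
    also have "\<dots> = (\<integral>\<^sup>+x. f x * h x * indicator {0..} x \<partial>lborel)" by (rule nn_integral_restrict_space) simp
    finally show ?thesis by (simp add: \<rho>_def ac_simps)
  qed
  define u where "u x = ennreal (V x)" for x
  have [measurable]: "u \<in> borel_measurable borel" unfolding u_def by simp
  have ptm: "pot_ext V \<in> borel_measurable borel"
    unfolding pot_ext_def[abs_def] by measurable
  have inner: "(\<integral>\<^sup>+x. pot_ext V (\<gamma> * (x - y)) \<partial>\<mu>) = (\<integral>\<^sup>+x. \<rho> x * u (\<gamma> * (x - y)) \<partial>lborel)" for y
  proof -
    have "(\<integral>\<^sup>+x. pot_ext V (\<gamma> * (x - y)) \<partial>\<mu>) = (\<integral>\<^sup>+x. \<rho> x * pot_ext V (\<gamma> * (x - y)) \<partial>lborel)"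
      by (rule int\<mu>) (use ptm in measurable)
    also have "\<dots> = (\<integral>\<^sup>+x. \<rho> x * u (\<gamma> * (x - y)) \<partial>lborel)"
    proof (rule nn_integral_cong_AE)
      show "AE x in lborel. \<rho> x * pot_ext V (\<gamma> * (x - y)) = \<rho> x * u (\<gamma> * (x - y))"
        using AE_lborel_singleton[of y] by eventually_elim (use \<gamma> in \<open>auto simp: pot_ext_def u_def\<close>)
    qed
    finally show ?thesis .
  qed
  have two: "(\<integral>\<^sup>+x. u x \<partial>lborel) = ennreal (2 * a)"
  proof -
    have "(\<integral>\<^sup>+x. u x \<partial>lborel) = ennreal (\<integral>x. V x \<partial>lborel)"
      unfolding u_def
    proof (rule nn_integral_eq_integral[OF V(2)])
      show "AE x in lborel. 0 \<le> V x"
        using AE_lborel_singleton[of "0::real"] by eventually_elim (rule even_nonneg[OF V])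
    qed
    then show ?thesis by (simp add: even_integral_half[OF V(2,3)] a_def)
  qed
  have sq: "(\<integral>\<^sup>+x. (\<rho> x)\<^sup>2 \<partial>lborel) = (\<integral>\<^sup>+x. (f x)\<^sup>2 \<partial>?L)"
    by (subst nn_integral_restrict_space)
      (auto intro!: nn_integral_cong simp: \<rho>_def indicator_def power2_eq_square)
  have "ennreal (1 / 2 * \<gamma>) * (\<integral>\<^sup>+y. (\<integral>\<^sup>+x. pot_ext V (\<gamma> * (x - y)) \<partial>\<mu>) \<partial>\<mu>)
      = ennreal (1 / 2) * (ennreal \<gamma> * (\<integral>\<^sup>+y. (\<integral>\<^sup>+x. \<rho> x * u (\<gamma> * (x - y)) \<partial>lborel) * \<rho> y \<partial>lborel))"
  proof -
    have "ennreal (1 / 2 * \<gamma>) = ennreal (1 / 2) * ennreal \<gamma>" by (rule ennreal_mult') simp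
    moreover have "(\<integral>\<^sup>+y. (\<integral>\<^sup>+x. \<rho> x * u (\<gamma> * (x - y)) \<partial>lborel) \<partial>\<mu>)
        = (\<integral>\<^sup>+y. \<rho> y * (\<integral>\<^sup>+x. \<rho> x * u (\<gamma> * (x - y)) \<partial>lborel) \<partial>lborel)"
      by (rule int\<mu>) simp
    ultimately show ?thesis unfolding inner by (simp only: ac_simps)
  qed
  also have "\<dots> \<le> ennreal (1 / 2) * ((\<integral>\<^sup>+x. u x \<partial>lborel) * (\<integral>\<^sup>+x. (\<rho> x)\<^sup>2 \<partial>lborel))"
    by (intro mult_left_mono interaction_upper_bound \<gamma>) auto
  also have "\<dots> = (ennreal (1 / 2) * ennreal (2 * a)) * (\<integral>\<^sup>+x. (f x)\<^sup>2 \<partial>?L)"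
    unfolding two sq by (simp add: mult.assoc)
  also have "ennreal (1 / 2) * ennreal (2 * a) = ennreal a"
    by (subst ennreal_mult'[symmetric]) auto
  finally have "energy V \<gamma> \<mu> \<le> ennreal a * (\<integral>\<^sup>+x. (f x)\<^sup>2 \<partial>?L) + (\<integral>\<^sup>+x. ennreal x \<partial>\<mu>)"
    unfolding energy_def by (rule add_right_mono)
  then show ?thesis unfolding limit_energy_density[OF f \<mu>] a_def .
qed

section \<open>The Gamma limit\<close>

lemma admissibleD:
  assumes "admissible V"
  shows "\<And>x. V (- x) = V x" "antimono_on {0<..} V" "integrable lborel V"
  using assms by (simp_all add: admissible_def)

text \<open>The Fourier transform at 0 is the total mass. Positivity of a allows the later division
  by it.\<close>

lemma admissible_half_integral_pos:
  assumes "admissible V"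
  shows "0 < (LBINT x:{0<..}. V x)"
proof -
  have "0 < Re (fourier V 0)" using assms by (simp add: admissible_def)
  also have "fourier V 0 = complex_of_real (\<integral>x. V x \<partial>lborel)" by (simp add: fourier_cis)
  finally show ?thesis using even_integral_half[OF admissibleD(3,1)[OF assms]] by simp
qed

lemma narrow_conv_on_line:
  fixes g :: "real \<Rightarrow> real"
  assumes \<mu>: "\<mu> \<in> prob_halfline" and m: "\<And>\<gamma>. m \<gamma> \<in> prob_halfline" and nc: "narrow_conv m \<mu> F"
    and g: "continuous_on UNIV g" "\<And>x. 0 \<le> g x" "\<And>x. g x \<le> B"
  shows "((\<lambda>\<gamma>. \<integral>x. g x \<partial>on_line (m \<gamma>)) \<longlongrightarrow> (\<integral>x. g x \<partial>on_line \<mu>)) F"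
proof -
  have [measurable]: "g \<in> borel_measurable borel" using g(1) by (rule borel_measurable_continuous_onI)
  have "bounded (g ` {0..})" unfolding bounded_iff using g(2,3) by (intro exI[of _ B]) auto
  then show ?thesis
    using nc continuous_on_subset[OF g(1), of "{0..}"]
    by (simp add: narrow_conv_def integral_on_line m \<mu>)
qed

text \<open>Two limits in a fixed order: \<gamma> to infinity for one bounded kernel
  \<open>W k\<close>, then k to infinity, where only the masses of the kernels remain. The bracket
  in g may be negative, so the inequality is kept in the reals and the lower limit is taken
  finite.\<close>

lemma Liminf_energy_lower_bound:
  assumes adm: "admissible V" and \<mu>: "\<mu> \<in> prob_halfline" and m: "\<And>\<gamma>. m \<gamma> \<in> prob_halfline"
    and nc: "narrow_conv m \<mu> at_top" and g: "bump_function g" and T: "0 \<le> T"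
    and L: "Liminf at_top (\<lambda>\<gamma>. energy V \<gamma> (m \<gamma>)) = ennreal L" "0 \<le> L"
  shows "(LBINT x:{0<..}. V x) * (2 * (\<integral>x. g x \<partial>on_line \<mu>) - (\<integral>x. (g x)\<^sup>2 \<partial>lborel)) + (\<integral>x. min x T \<partial>\<mu>) \<le> L"
proof -
  note even = admissibleD(1)[OF adm] and mono = admissibleD(2)[OF adm] and V = admissibleD(3)[OF adm]
  obtain B where gb: "continuous_on UNIV g" "\<And>x. 0 \<le> g x" "\<And>x. g x \<le> B"
    using bump_functionE[OF g] by metis
  let ?q = "2 * (\<integral>x. g x \<partial>on_line \<mu>) - (\<integral>x. (g x)\<^sup>2 \<partial>lborel)"
  obtain W :: "nat \<Rightarrow> real \<Rightarrow> real" where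
    W': "\<forall>k. continuous_on UNIV (W k) \<and> bounded (range (W k)) \<and> integrable lborel (W k) \<and>
             (\<forall>\<omega>. fourier (W k) \<omega> \<in> \<real> \<and> 0 \<le> Re (fourier (W k) \<omega>))"
    and inc: "AE x in lborel. incseq (\<lambda>k. W k x) \<and> (\<lambda>k. W k x) \<longlonglongrightarrow> V x"
    and L1: "(\<lambda>k. \<integral>x. \<bar>V x - W k x\<bar> \<partial>lborel) \<longlonglongrightarrow> 0"
    using adm unfolding admissible_def by blast
  have W: "continuous_on UNIV (W k)" "bounded (range (W k))" "integrable lborel (W k)"
    "fourier (W k) w \<in> \<real> \<and> 0 \<le> Re (fourier (W k) w)" for k w
    using W' by auto
  have glim: "((\<lambda>\<gamma>. \<integral>x. g x \<partial>on_line (m \<gamma>)) \<longlongrightarrow> (\<integral>x. g x \<partial>on_line \<mu>)) at_top"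
    by (rule narrow_conv_on_line[OF \<mu> m nc gb])
  have Tlim: "((\<lambda>\<gamma>. \<integral>x. min x T \<partial>m \<gamma>) \<longlongrightarrow> (\<integral>x. min x T \<partial>\<mu>)) at_top"
  proof -
    have "continuous_on {0..} (\<lambda>x. min x T)" by (intro continuous_intros)
    moreover have "bounded ((\<lambda>x. min x T) ` {0..})"
      unfolding bounded_iff using T by (intro exI[of _ T]) auto
    ultimately show ?thesis using nc unfolding narrow_conv_def by blast
  qed
  have step: "1 / 2 * ((\<integral>x. W k x \<partial>lborel) * ?q) + (\<integral>x. min x T \<partial>\<mu>) \<le> L" for k
  proof -
    obtain K where K: "\<And>z. \<bar>W k z\<bar> \<le> K" using W(2)[of k] by (auto simp: bounded_iff)
    have "AE x in lborel. W k x \<le> V x" using inc by eventually_elim (auto intro: incseq_le)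
    then have le: "ennreal (W k z) \<le> pot_ext V z" for z by (rule le_pot_ext[OF even mono W(1)])
    obtain A where A: "(A \<longlongrightarrow> (\<integral>x. W k x \<partial>lborel) * ?q) at_top"
      "\<And>\<gamma>. \<gamma> > 0 \<Longrightarrow> A \<gamma> \<le> \<gamma> * interaction (\<lambda>z. W k (\<gamma> * z)) (on_line (m \<gamma>)) (on_line (m \<gamma>))"
      using interaction_energy_lower_bound[OF W(1) K W(3,4) g prob_space_on_line[OF m] sets_on_line glim] by blast
    have "((\<lambda>\<gamma>. ennreal (1 / 2 * A \<gamma> + (\<integral>x. min x T \<partial>m \<gamma>))) \<longlongrightarrow>
        ennreal (1 / 2 * ((\<integral>x. W k x \<partial>lborel) * ?q) + (\<integral>x. min x T \<partial>\<mu>))) at_top"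
      by (intro tendsto_ennrealI tendsto_intros A Tlim)
    then have "ennreal (1 / 2 * ((\<integral>x. W k x \<partial>lborel) * ?q) + (\<integral>x. min x T \<partial>\<mu>))
        = Liminf at_top (\<lambda>\<gamma>. ennreal (1 / 2 * A \<gamma> + (\<integral>x. min x T \<partial>m \<gamma>)))"
      by (intro lim_imp_Liminf[symmetric]) auto
    also have "\<dots> \<le> Liminf at_top (\<lambda>\<gamma>. energy V \<gamma> (m \<gamma>))"
    proof (rule Liminf_mono)
      show "\<forall>\<^sub>F \<gamma> in at_top. ennreal (1 / 2 * A \<gamma> + (\<integral>x. min x T \<partial>m \<gamma>)) \<le> energy V \<gamma> (m \<gamma>)"
        using eventually_gt_at_top[of 0]
      proof eventually_elim
        case (elim \<gamma>)
        have "ennreal (1 / 2 * A \<gamma> + (\<integral>x. min x T \<partial>m \<gamma>))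
          \<le> ennreal (1 / 2 * (\<gamma> * interaction (\<lambda>z. W k (\<gamma> * z)) (on_line (m \<gamma>)) (on_line (m \<gamma>))) + (\<integral>x. min x T \<partial>m \<gamma>))"
          using A(2)[OF elim] by (intro ennreal_leI) simp
        also have "\<dots> \<le> energy V \<gamma> (m \<gamma>)"
          by (rule energy_lower_bound[OF m elim T W(1) K le])
        finally show ?case .
      qed
    qed
    \<comment> \<open>Since \<open>0 \<le> L\<close>, comparing in \<open>ennreal\<close> gives the
      real inequality even when its left-hand side is negative.\<close>
    finally show ?thesis unfolding L(1) using L(2) by (simp add: ennreal_le_iff)
  qed
  have Wlim: "(\<lambda>k. \<integral>x. W k x \<partial>lborel) \<longlonglongrightarrow> (\<integral>x. V x \<partial>lborel)"
  proof (rule LIM_zero_cancel, rule Lim_null_comparison[OF _ L1], rule always_eventually, rule allI)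
    fix k
    have "norm ((\<integral>x. W k x \<partial>lborel) - (\<integral>x. V x \<partial>lborel)) = \<bar>\<integral>x. V x - W k x \<partial>lborel\<bar>"
      using V W(3)[of k] by simp
    also have "\<dots> \<le> (\<integral>x. \<bar>V x - W k x\<bar> \<partial>lborel)" by (rule integral_abs_bound)
    finally show "norm ((\<integral>x. W k x \<partial>lborel) - (\<integral>x. V x \<partial>lborel)) \<le> (\<integral>x. \<bar>V x - W k x\<bar> \<partial>lborel)" .
  qed
  have "(\<lambda>k. 1 / 2 * ((\<integral>x. W k x \<partial>lborel) * ?q) + (\<integral>x. min x T \<partial>\<mu>))
      \<longlonglongrightarrow> 1 / 2 * ((\<integral>x. V x \<partial>lborel) * ?q) + (\<integral>x. min x T \<partial>\<mu>)"
    by (intro tendsto_intros Wlim)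
  then have "1 / 2 * ((\<integral>x. V x \<partial>lborel) * ?q) + (\<integral>x. min x T \<partial>\<mu>) \<le> L"
    by (rule LIMSEQ_le_const2) (use step in auto)
  then show ?thesis by (simp add: even_integral_half[OF V even])
qed

lemma halfline_density_on_line:
  assumes \<mu>: "\<mu> \<in> prob_halfline" and r: "r \<in> borel_measurable borel"
    and dens: "on_line \<mu> = density lborel (\<lambda>x. ennreal (r x))"
  shows "\<mu> = density (restrict_space lborel {0..}) (\<lambda>x. ennreal (r x))"
proof (rule measure_eqI)
  let ?L = "restrict_space lborel {0::real..}"
  have sets_mu: "sets \<mu> = sets (restrict_space borel {0..})" using \<mu> by (simp add: prob_halfline_def)
  show "sets \<mu> = sets (density ?L (\<lambda>x. ennreal (r x)))"
    by (simp add: sets_mu sets_restrict_space)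
  fix A assume "A \<in> sets \<mu>"
  then have A: "A \<in> sets borel" "A \<subseteq> {0..}" by (auto simp: sets_mu sets_restrict_space_iff)
  have AL: "A \<in> sets ?L" using A by (simp add: sets_restrict_space_iff)
  have rL: "(\<lambda>x. ennreal (r x)) \<in> borel_measurable ?L" by (rule measurable_restrict_space1) (use r in simp)
  have "emeasure \<mu> A = emeasure (on_line \<mu>) A"
    unfolding on_line_def
    by (subst emeasure_distr[OF halfline_measurable_id[OF \<mu>] A(1)]) (use A(2) in \<open>simp add: space_halfline[OF \<mu>] Int_absorb2\<close>)
  also have "\<dots> = (\<integral>\<^sup>+x. ennreal (r x) * indicator A x \<partial>lborel)"
    unfolding dens using A(1) r by (subst emeasure_density) auto
  also have "\<dots> = (\<integral>\<^sup>+x. ennreal (r x) * indicator A x * indicator {0..} x \<partial>lborel)"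
    using A(2) by (intro nn_integral_cong) (auto simp: indicator_def)
  also have "\<dots> = (\<integral>\<^sup>+x. ennreal (r x) * indicator A x \<partial>?L)"
    by (rule nn_integral_restrict_space[symmetric]) simp
  also have "\<dots> = emeasure (density ?L (\<lambda>x. ennreal (r x))) A"
    by (rule emeasure_density[OF rL AL, symmetric])
  finally show "emeasure \<mu> A = emeasure (density ?L (\<lambda>x. ennreal (r x))) A" .
qed

text \<open>For a finite lower limit L and a truncation level T, varying g gives a density whose
  squared L^2 norm is at most (L - c T) / a. So a times this norm plus the truncated moment is at
  most L, and T is sent to infinity last.\<close>

lemma limit_energy_le_Liminf:
  assumes adm: "admissible V" and \<mu>: "\<mu> \<in> prob_halfline" and m: "\<And>\<gamma>. m \<gamma> \<in> prob_halfline"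
    and nc: "narrow_conv m \<mu> at_top"
  shows "limit_energy (LBINT x:{0<..}. V x) \<mu> \<le> Liminf at_top (\<lambda>\<gamma>. energy V \<gamma> (m \<gamma>))"
proof (cases "Liminf at_top (\<lambda>\<gamma>. energy V \<gamma> (m \<gamma>))")
  case (real L)
  let ?L = "restrict_space lborel {0::real..}"
  define a where "a = (LBINT x:{0<..}. V x)"
  have a: "a > 0" unfolding a_def by (rule admissible_half_integral_pos[OF adm])
  define M where "M = on_line \<mu>"
  have fM: "finite_measure M" and sM: "sets M = sets borel"
    using prob_space_on_line[OF \<mu>] by (simp_all add: M_def prob_space_def sets_on_line)
  define c where "c T = (\<integral>x. min x T \<partial>\<mu>)" for T
  have bound: "a * (2 * (\<integral>x. g x \<partial>M) - (\<integral>x. (g x)\<^sup>2 \<partial>lborel)) + c T \<le> L" if "bump_function g" "0 \<le> T" for g T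
    unfolding a_def M_def c_def by (rule Liminf_energy_lower_bound[OF adm \<mu> m nc that real(2,1)])
  have dens: "\<exists>r \<in> borel_measurable borel. (\<forall>x. 0 \<le> r x) \<and> M = density lborel (\<lambda>x. ennreal (r x))
    \<and> (\<integral>\<^sup>+x. (ennreal (r x))\<^sup>2 \<partial>lborel) \<le> ennreal ((L - c T) / a)" if T: "0 \<le> T" for T
  proof (rule L2_bound_imp_density[OF fM sM])
    fix g assume "bump_function g"
    from bound[OF this T] a show "2 * (\<integral>x. g x \<partial>M) - (\<integral>x. (g x)\<^sup>2 \<partial>lborel) \<le> (L - c T) / a"
      by (simp add: field_simps)
  qed
  have bump0: "bump_function (\<lambda>_. 0)" by (simp add: bump_function_def)
  have ex: "\<exists>r. (\<lambda>x. ennreal (r x)) \<in> borel_measurable ?L \<and> \<mu> = density ?L (\<lambda>x. ennreal (r x))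
      \<and> (\<integral>\<^sup>+x. (ennreal (r x))\<^sup>2 \<partial>?L) \<le> ennreal ((L - c T) / a)" if T: "0 \<le> T" for T
  proof -
    obtain r where r: "r \<in> borel_measurable borel" "M = density lborel (\<lambda>x. ennreal (r x))"
      "(\<integral>\<^sup>+x. (ennreal (r x))\<^sup>2 \<partial>lborel) \<le> ennreal ((L - c T) / a)" using dens[OF T] by blast
    have "(\<lambda>x. ennreal (r x)) \<in> borel_measurable ?L"
      by (rule measurable_restrict_space1) (use r(1) in simp)
    moreover have "\<mu> = density ?L (\<lambda>x. ennreal (r x))"
      by (rule halfline_density_on_line[OF \<mu> r(1) r(2)[unfolded M_def]])
    moreover have "(\<integral>\<^sup>+x. (ennreal (r x))\<^sup>2 \<partial>?L) \<le> (\<integral>\<^sup>+x. (ennreal (r x))\<^sup>2 \<partial>lborel)"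
      by (subst nn_integral_restrict_space) (auto intro!: nn_integral_mono simp: indicator_def)
    ultimately show ?thesis using order_trans[OF _ r(3)] by blast
  qed
  obtain r where rL: "(\<lambda>x. ennreal (r x)) \<in> borel_measurable ?L"
    and r\<mu>: "\<mu> = density ?L (\<lambda>x. ennreal (r x))"
    using ex[OF order_refl] by blast
  define f where "f x = ennreal (r x)" for x
  have f: "f \<in> borel_measurable ?L" "\<mu> = density ?L f"
    using rL r\<mu> unfolding f_def[abs_def] by blast+
  \<comment> \<open>Each T comes with a density of its own; almost everywhere uniqueness transfers
    all the bounds to the single f fixed at T = 0.\<close>
  have fb: "(\<integral>\<^sup>+x. (f x)\<^sup>2 \<partial>?L) \<le> ennreal ((L - c T) / a)" if T: "0 \<le> T" for T
  proof -
    obtain s where s: "(\<lambda>x. ennreal (s x)) \<in> borel_measurable ?L" "\<mu> = density ?L (\<lambda>x. ennreal (s x))"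
      "(\<integral>\<^sup>+x. (ennreal (s x))\<^sup>2 \<partial>?L) \<le> ennreal ((L - c T) / a)" using ex[OF T] by blast
    have "density ?L f = density ?L (\<lambda>x. ennreal (s x))" by (rule trans[OF f(2)[symmetric] s(2)])
    then have "AE x in ?L. f x = ennreal (s x)"
      by (rule sigma_finite_measure.density_unique_iff[OF sigma_finite_lborel_halfline f(1) s(1), THEN iffD1])
    then have "(\<integral>\<^sup>+x. (f x)\<^sup>2 \<partial>?L) = (\<integral>\<^sup>+x. (ennreal (s x))\<^sup>2 \<partial>?L)"
      by (intro nn_integral_cong_AE) (auto elim!: eventually_mono)
    then show ?thesis using s(3) by simp
  qed
  have bT: "ennreal a * (\<integral>\<^sup>+x. (f x)\<^sup>2 \<partial>?L) + (\<integral>\<^sup>+x. ennreal (min x (real T)) \<partial>\<mu>) \<le> ennreal L" for T :: nat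
  proof -
    have pm: "finite_measure \<mu>" using \<mu> by (auto simp: prob_halfline_def prob_space_def)
    have "integrable \<mu> (\<lambda>x. min x (real T))"
      by (rule finite_measure.integrable_const_bound[OF pm, of _ "real T"])
        (use halfline_measurable_id[OF \<mu>] in \<open>auto intro!: AE_I2 simp: space_halfline[OF \<mu>]\<close>)
    then have eq: "(\<integral>\<^sup>+x. ennreal (min x (real T)) \<partial>\<mu>) = ennreal (c (real T))"
      unfolding c_def by (rule nn_integral_eq_integral) (auto intro!: AE_I2 simp: space_halfline[OF \<mu>])
    have c0: "0 \<le> c (real T)" unfolding c_def
      by (rule integral_nonneg_AE) (auto intro!: AE_I2 simp: space_halfline[OF \<mu>])
    \<comment> \<open>Testing with g = 0 shows that L - c T is nonnegative, so
      \<open>ennreal\<close> does not truncate it.\<close>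
    have cL: "c (real T) \<le> L" using bound[OF bump0, of "real T"] by simp
    have "ennreal a * (\<integral>\<^sup>+x. (f x)\<^sup>2 \<partial>?L) \<le> ennreal a * ennreal ((L - c (real T)) / a)"
      by (intro mult_left_mono fb) auto
    also have "\<dots> = ennreal (L - c (real T))"
      using a by (subst ennreal_mult'[symmetric]) auto
    finally have "ennreal a * (\<integral>\<^sup>+x. (f x)\<^sup>2 \<partial>?L) + ennreal (c (real T)) \<le> ennreal (L - c (real T)) + ennreal (c (real T))"
      by (rule add_right_mono)
    also have "\<dots> = ennreal L" using c0 cL by (subst ennreal_plus[symmetric]) auto
    finally show ?thesis unfolding eq .
  qed
  have "(\<lambda>T::nat. \<integral>\<^sup>+x. ennreal (min x (real T)) \<partial>\<mu>) \<longlonglongrightarrow> (\<integral>\<^sup>+x. ennreal x \<partial>\<mu>)"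
  proof (rule nn_integral_LIMSEQ)
    show "incseq (\<lambda>T::nat. \<lambda>x::real. ennreal (min x (real T)))"
      by (auto simp: incseq_def le_fun_def intro!: ennreal_leI)
    show "(\<lambda>x. ennreal (min x (real T))) \<in> borel_measurable \<mu>" for T
      using halfline_measurable_id[OF \<mu>] by simp
    show "(\<lambda>T. ennreal (min x (real T))) \<longlonglongrightarrow> ennreal x" for x
    proof (rule tendsto_eventually)
      obtain N where "x < real N" using reals_Archimedean2 by blast
      then show "\<forall>\<^sub>F T in sequentially. ennreal (min x (real T)) = ennreal x"
        by (intro eventually_sequentiallyI[of N]) (simp add: min_def)
    qed
  qed
  then have "(\<lambda>T::nat. ennreal a * (\<integral>\<^sup>+x. (f x)\<^sup>2 \<partial>?L) + (\<integral>\<^sup>+x. ennreal (min x (real T)) \<partial>\<mu>))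
      \<longlonglongrightarrow> ennreal a * (\<integral>\<^sup>+x. (f x)\<^sup>2 \<partial>?L) + (\<integral>\<^sup>+x. ennreal x \<partial>\<mu>)"
    by (intro tendsto_intros)
  then have "ennreal a * (\<integral>\<^sup>+x. (f x)\<^sup>2 \<partial>?L) + (\<integral>\<^sup>+x. ennreal x \<partial>\<mu>) \<le> ennreal L"
    by (rule LIMSEQ_le_const2) (use bT in auto)
  then show ?thesis unfolding real(2) a_def[symmetric] limit_energy_density[OF f] .
next
  case top
  then show ?thesis by simp
qed

lemma narrow_Gamma_limit_energy:
  assumes adm: "admissible V"
  shows "narrow_Gamma_limit (energy V) (limit_energy (LBINT x:{0<..}. V x))"
  unfolding narrow_Gamma_limit_def
proof (intro conjI ballI allI impI)
  fix \<mu> and m :: "real \<Rightarrow> real measure"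
  assume \<mu>: "\<mu> \<in> prob_halfline" and m: "\<forall>\<gamma>>0. m \<gamma> \<in> prob_halfline" and nc: "narrow_conv m \<mu> at_top"
  \<comment> \<open>Nothing is known about \<open>m \<gamma>\<close> for \<gamma> \<le> 0, while the
    preceding lemmas take a probability measure for every \<gamma>; the change is invisible at
    infinity.\<close>
  define n where "n \<gamma> = (if \<gamma> > 0 then m \<gamma> else m 1)" for \<gamma> :: real
  have ev: "\<forall>\<^sub>F \<gamma> in at_top. n \<gamma> = m \<gamma>"
    using eventually_gt_at_top[of 0] by eventually_elim (simp add: n_def)
  have "narrow_conv n \<mu> at_top"
    unfolding narrow_conv_def
  proof (intro allI impI)
    fix f :: "real \<Rightarrow> real" assume f: "continuous_on {0..} f" "bounded (f ` {0..})"
    have "((\<lambda>i. \<integral>x. f x \<partial>m i) \<longlongrightarrow> (\<integral>x. f x \<partial>\<mu>)) at_top" using nc f unfolding narrow_conv_def by blast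
    moreover have "\<forall>\<^sub>F i in at_top. (\<integral>x. f x \<partial>m i) = (\<integral>x. f x \<partial>n i)"
      using ev by eventually_elim simp
    ultimately show "((\<lambda>i. \<integral>x. f x \<partial>n i) \<longlongrightarrow> (\<integral>x. f x \<partial>\<mu>)) at_top" by (rule Lim_transform_eventually)
  qed
  moreover have "n \<gamma> \<in> prob_halfline" for \<gamma> using m by (simp add: n_def)
  ultimately have "limit_energy (LBINT x:{0<..}. V x) \<mu> \<le> Liminf at_top (\<lambda>\<gamma>. energy V \<gamma> (n \<gamma>))"
    using limit_energy_le_Liminf[OF adm \<mu>, of n] by blast
  also have "\<dots> \<le> Liminf at_top (\<lambda>\<gamma>. energy V \<gamma> (m \<gamma>))"
    by (rule Liminf_mono) (use ev in \<open>auto elim!: eventually_mono\<close>)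
  finally show "limit_energy (LBINT x:{0<..}. V x) \<mu> \<le> Liminf at_top (\<lambda>\<gamma>. energy V \<gamma> (m \<gamma>))" .
next
  fix \<mu> assume \<mu>: "\<mu> \<in> prob_halfline"
  have "Limsup at_top (\<lambda>\<gamma>. energy V \<gamma> \<mu>) \<le> Limsup at_top (\<lambda>\<gamma>::real. limit_energy (LBINT x:{0<..}. V x) \<mu>)"
  proof (rule Limsup_mono)
    show "\<forall>\<^sub>F \<gamma> in at_top. energy V \<gamma> \<mu> \<le> limit_energy (LBINT x:{0<..}. V x) \<mu>"
      using eventually_gt_at_top[of 0]
      by eventually_elim (intro energy_le_limit_energy admissibleD[OF adm])
  qed
  then have "Limsup at_top (\<lambda>\<gamma>. energy V \<gamma> \<mu>) \<le> limit_energy (LBINT x:{0<..}. V x) \<mu>"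
    by (simp add: Limsup_const)
  then show "\<exists>m. (\<forall>\<gamma>>0. m \<gamma> \<in> prob_halfline) \<and> narrow_conv m \<mu> at_top \<and>
      Limsup at_top (\<lambda>\<gamma>. energy V \<gamma> (m \<gamma>)) \<le> limit_energy (LBINT x:{0<..}. V x) \<mu>"
    using \<mu> by (intro exI[of _ "\<lambda>_. \<mu>"]) (simp add: narrow_conv_def)
qed

theorem theorem2p1:
  fixes V :: "real \<Rightarrow> real"
  assumes "admissible V"
  shows "narrow_Gamma_limit (energy V) (limit_energy (LBINT x:{0<..}. V x)) \<and>
    (\<forall>(\<gamma> :: nat \<Rightarrow> real) (m :: nat \<Rightarrow> real measure) (C :: real).
       (\<forall>n. 0 < \<gamma> n) \<longrightarrow> (\<forall>n. m n \<in> prob_halfline) \<longrightarrow>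
       (\<forall>n. energy V (\<gamma> n) (m n) \<le> ennreal C) \<longrightarrow>
       (\<exists>\<mu>\<in>prob_halfline. \<exists>r :: nat \<Rightarrow> nat. strict_mono r \<and>
          narrow_conv (\<lambda>n. m (r n)) \<mu> sequentially))"
proof (intro conjI allI impI)
  show "narrow_Gamma_limit (energy V) (limit_energy (LBINT x:{0<..}. V x))"
    by (rule narrow_Gamma_limit_energy[OF assms])
next
  fix \<gamma> :: "nat \<Rightarrow> real" and m :: "nat \<Rightarrow> real measure" and C :: real
  assume m: "\<forall>n. m n \<in> prob_halfline" and C: "\<forall>n. energy V (\<gamma> n) (m n) \<le> ennreal C"
  have mo: "(\<integral>\<^sup>+x. ennreal x \<partial>m n) \<le> ennreal C" for n
  proof -
    have "(\<integral>\<^sup>+x. ennreal x \<partial>m n) \<le> energy V (\<gamma> n) (m n)" unfolding energy_def by simp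
    then show ?thesis using C by (meson order_trans)
  qed
  show "\<exists>\<mu>\<in>prob_halfline. \<exists>r :: nat \<Rightarrow> nat. strict_mono r \<and> narrow_conv (\<lambda>n. m (r n)) \<mu> sequentially"
    by (rule narrow_compactness) (use m mo in auto)
qed

end
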